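(* Let $G$ be a finite simple group. (a) If $G$ is a normal complement to a subgroup $U$ in a group $\Gamma$, then every normal complement of $U$ in $\Gamma$ is isomorphic to $G$. (b) Hence if $E/k$ is a pre-Galois extension for which the simple group $G$ is a pre-Galois group, then every pre-Galois group of $E/k$ is isomorphic to $G$.
   Context: A subgroup $V$ is a complement of a subgroup $U$ in $\Gamma$ if every element of $\Gamma$ can be uniquely written as $vu$ with $v\in V$, $u\in U$; it is a normal complement if moreover $V$ is normal in $\Gamma$. A finite field extension $E/k$ is pre-Galois, with pre-Galois group $G$, if there is a finite Galois extension $L/k$ such that $E\otimes_kL$ is a Galois field extension of $L$ with Galois group $G$ (different choices of $L$ may give different groups). *)

theory Defs
  imports "HOL-Algebra.Algebra"
begin

section \<open>Complements\<close>

definition complement_of :: "('a, 'm) monoid_scheme \<Rightarrow> 'a set \<Rightarrow> 'a set \<Rightarrow> bool"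
  where "complement_of \<Gamma> U V \<longleftrightarrow>
    subgroup U \<Gamma> \<and> subgroup V \<Gamma> \<and>
    (\<forall>x \<in> carrier \<Gamma>. \<exists>!p. p \<in> V \<times> U \<and> x = fst p \<otimes>\<^bsub>\<Gamma>\<^esub> snd p)"

definition normal_complement_of :: "('a, 'm) monoid_scheme \<Rightarrow> 'a set \<Rightarrow> 'a set \<Rightarrow> bool"
  where "normal_complement_of \<Gamma> U V \<longleftrightarrow> complement_of \<Gamma> U V \<and> V \<lhd> \<Gamma>"

section \<open>Finite and Galois field extensions\<close>

text \<open>An extension \<open>E/k\<close> is given by its structure map \<open>i : k \<rightarrow> E\<close>, which is automatically
  injective, so that one field \<open>k\<close> can be embedded in several fields of unrelated types.\<close>

definition finite_field_ext ::
    "('k, 'p) ring_scheme \<Rightarrow> ('e, 'q) ring_scheme \<Rightarrow> ('k \<Rightarrow> 'e) \<Rightarrow> bool"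
  where "finite_field_ext k E i \<longleftrightarrow>
    field k \<and> field E \<and> i \<in> ring_hom k E \<and>
    ring.finite_dimension E (i ` carrier k) (carrier E)"

text \<open>As in \<^const>\<open>AutoGroup\<close>, automorphisms are taken extensional so that each one is
  represented by exactly one HOL function.\<close>

definition galois_group ::
    "('k, 'p) ring_scheme \<Rightarrow> ('e, 'q) ring_scheme \<Rightarrow> ('k \<Rightarrow> 'e) \<Rightarrow> ('e \<Rightarrow> 'e) monoid"
  where "galois_group k E i = BijGroup (carrier E)
    \<lparr>carrier := {\<sigma> \<in> Bij (carrier E). \<sigma> \<in> ring_hom E E \<and> (\<forall>a \<in> carrier k. \<sigma> (i a) = i a)}\<rparr>"

text \<open>Artin's definition: the fixed field of the automorphism group is the base field.\<close>

definition finite_galois_ext ::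
    "('k, 'p) ring_scheme \<Rightarrow> ('e, 'q) ring_scheme \<Rightarrow> ('k \<Rightarrow> 'e) \<Rightarrow> bool"
  where "finite_galois_ext k E i \<longleftrightarrow>
    finite_field_ext k E i \<and>
    {x \<in> carrier E. \<forall>\<sigma> \<in> carrier (galois_group k E i). \<sigma> x = x} = i ` carrier k"

section \<open>Tensor products of algebras\<close>

text \<open>The integral monoid ring of \<open>M\<close>: the free abelian group on the carrier, with the
  biadditive extension of the multiplication of \<open>M\<close>.\<close>

definition monoid_ring :: "('a, 'm) monoid_scheme \<Rightarrow> ('a \<Rightarrow>\<^sub>0 int) ring"
  where "monoid_ring M =
    \<lparr>carrier = {c. Poly_Mapping.keys c \<subseteq> carrier M},
     monoid.mult = (\<lambda>x y. frag_extend (\<lambda>a. frag_extend (\<lambda>b. frag_of (a \<otimes>\<^bsub>M\<^esub> b)) y) x),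
     one = frag_of \<one>\<^bsub>M\<^esub>, ring.zero = 0, ring.add = (+)\<rparr>"

text \<open>\<open>E \<otimes>\<^sub>k L\<close> is the quotient of the free abelian group on \<open>E \<times> L\<close> by the subgroup that
  the following \<open>k\<close>-bilinearity relations generate. They are stable under multiplication by
  pairs, so this subgroup is the ideal they generate in the monoid ring of \<open>E \<times> L\<close>, and the
  quotient ring has the product \<open>(e \<otimes> l) (e' \<otimes> l') = e e' \<otimes> l l'\<close>.\<close>

definition bilinear_relations ::
    "('k, 'p) ring_scheme \<Rightarrow> ('e, 'q) ring_scheme \<Rightarrow> ('k \<Rightarrow> 'e) \<Rightarrow>
     ('l, 'r) ring_scheme \<Rightarrow> ('k \<Rightarrow> 'l) \<Rightarrow> ('e \<times> 'l \<Rightarrow>\<^sub>0 int) set"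
  where "bilinear_relations k E i L j =
    {frag_of (e \<oplus>\<^bsub>E\<^esub> e', l) - frag_of (e, l) - frag_of (e', l) |e e' l.
       e \<in> carrier E \<and> e' \<in> carrier E \<and> l \<in> carrier L} \<union>
    {frag_of (e, l \<oplus>\<^bsub>L\<^esub> l') - frag_of (e, l) - frag_of (e, l') |e l l'.
       e \<in> carrier E \<and> l \<in> carrier L \<and> l' \<in> carrier L} \<union>
    {frag_of (i a \<otimes>\<^bsub>E\<^esub> e, l) - frag_of (e, j a \<otimes>\<^bsub>L\<^esub> l) |a e l.
       a \<in> carrier k \<and> e \<in> carrier E \<and> l \<in> carrier L}"

definition tensor_ideal ::
    "('k, 'p) ring_scheme \<Rightarrow> ('e, 'q) ring_scheme \<Rightarrow> ('k \<Rightarrow> 'e) \<Rightarrow>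
     ('l, 'r) ring_scheme \<Rightarrow> ('k \<Rightarrow> 'l) \<Rightarrow> ('e \<times> 'l \<Rightarrow>\<^sub>0 int) set"
  where "tensor_ideal k E i L j = Idl\<^bsub>monoid_ring (E \<times>\<times> L)\<^esub> (bilinear_relations k E i L j)"

definition tensor_ring ::
    "('k, 'p) ring_scheme \<Rightarrow> ('e, 'q) ring_scheme \<Rightarrow> ('k \<Rightarrow> 'e) \<Rightarrow>
     ('l, 'r) ring_scheme \<Rightarrow> ('k \<Rightarrow> 'l) \<Rightarrow> ('e \<times> 'l \<Rightarrow>\<^sub>0 int) set ring"
  where "tensor_ring k E i L j = monoid_ring (E \<times>\<times> L) Quot tensor_ideal k E i L j"

definition pure_tensor ::
    "('k, 'p) ring_scheme \<Rightarrow> ('e, 'q) ring_scheme \<Rightarrow> ('k \<Rightarrow> 'e) \<Rightarrow>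
     ('l, 'r) ring_scheme \<Rightarrow> ('k \<Rightarrow> 'l) \<Rightarrow> 'e \<Rightarrow> 'l \<Rightarrow> ('e \<times> 'l \<Rightarrow>\<^sub>0 int) set"
  where "pure_tensor k E i L j e l = tensor_ideal k E i L j +>\<^bsub>monoid_ring (E \<times>\<times> L)\<^esub> frag_of (e, l)"

text \<open>Without the following, \<^const>\<open>genideal\<close> could be degenerate, since \<^const>\<open>ideal\<close>
  presupposes a ring.\<close>

lemma monoid_ring_is_cring:
  assumes "comm_monoid M"
  shows "cring (monoid_ring M)"
proof -
  interpret comm_monoid M by fact
  let ?R = "monoid_ring M"
  let ?m = "\<lambda>x y. frag_extend (\<lambda>a. frag_extend (\<lambda>b. frag_of (a \<otimes>\<^bsub>M\<^esub> b)) y) x"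
  have addl: "?m (x + y) z = ?m x z + ?m y z" for x y z
    by (simp add: frag_extend_add)
  have subl: "?m (x - y) z = ?m x z - ?m y z" for x y z
    by (simp add: frag_extend_diff)
  have subr: "?m x (y - z) = ?m x y - ?m x z" for x y z
    using subset_UNIV[of "Poly_Mapping.keys x"]
    by (induction x rule: frag_induction) (simp_all add: frag_extend_diff)
  have closed: "Poly_Mapping.keys (?m x y) \<subseteq> carrier M"
    if x: "Poly_Mapping.keys x \<subseteq> carrier M" and y: "Poly_Mapping.keys y \<subseteq> carrier M" for x y
  proof -
    have "Poly_Mapping.keys (frag_extend (\<lambda>b. frag_of (a \<otimes>\<^bsub>M\<^esub> b)) y) \<subseteq> carrier M"
      if "a \<in> carrier M" for a
      by (rule order_trans[OF keys_frag_extend]) (use that y in \<open>auto simp: subset_iff\<close>)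
    with x show ?thesis
      by (intro order_trans[OF keys_frag_extend]) blast
  qed
  have comm: "?m x y = ?m y x"
    if x: "Poly_Mapping.keys x \<subseteq> carrier M" and y: "Poly_Mapping.keys y \<subseteq> carrier M" for x y
    using x
  proof (induction x rule: frag_induction)
    case (one a)
    show ?case using y
      by (induction y rule: frag_induction) (use one in \<open>simp_all add: m_comm frag_extend_diff\<close>)
  next
    case (diff a b) then show ?case by (metis subl subr)
  qed (simp add: frag_extend_eq_0)
  have assoc: "?m (?m x y) z = ?m x (?m y z)"
    if x: "Poly_Mapping.keys x \<subseteq> carrier M" and y: "Poly_Mapping.keys y \<subseteq> carrier M"
      and z: "Poly_Mapping.keys z \<subseteq> carrier M" for x y z
    using x
  proof (induction x rule: frag_induction)
    case (one a)
    show ?case using y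
    proof (induction y rule: frag_induction)
      case (one b)
      show ?case using z
        by (induction z rule: frag_induction)
          (use \<open>a \<in> carrier M\<close> one in \<open>simp_all add: m_assoc frag_extend_diff\<close>)
    next
      case (diff b c) then show ?case by (metis subl subr)
    qed (simp add: frag_extend_eq_0)
  next
    case (diff a b) then show ?case by (metis subl)
  qed simp
  have one: "?m (frag_of \<one>\<^bsub>M\<^esub>) x = x" if x: "Poly_Mapping.keys x \<subseteq> carrier M" for x
    using x by (induction x rule: frag_induction) (simp_all add: frag_extend_diff)
  have "abelian_group ?R"
  proof (rule abelian_groupI)
    fix x assume "x \<in> carrier ?R"
    then show "\<exists>y \<in> carrier ?R. y \<oplus>\<^bsub>?R\<^esub> x = \<zero>\<^bsub>?R\<^esub>"
      by (intro bexI[of _ "- x"]) (auto simp: monoid_ring_def)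
  next
    fix x y assume "x \<in> carrier ?R" "y \<in> carrier ?R"
    then show "x \<oplus>\<^bsub>?R\<^esub> y \<in> carrier ?R"
      using keys_add[of x y] by (auto simp: monoid_ring_def)
  qed (auto simp: monoid_ring_def algebra_simps)
  moreover have "comm_monoid ?R"
    by (rule comm_monoidI)
      (use closed assoc one comm in \<open>simp_all add: monoid_ring_def\<close>)
  ultimately show ?thesis
    by (rule cringI) (simp add: monoid_ring_def addl)
qed

section \<open>Pre-Galois extensions\<close>

definition pre_galois_via ::
    "('k, 'p) ring_scheme \<Rightarrow> ('e, 'q) ring_scheme \<Rightarrow> ('k \<Rightarrow> 'e) \<Rightarrow>
     ('l, 'r) ring_scheme \<Rightarrow> ('k \<Rightarrow> 'l) \<Rightarrow> ('g, 'm) monoid_scheme \<Rightarrow> bool"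
  where "pre_galois_via k E i L j G \<longleftrightarrow>
    finite_galois_ext k L j \<and>
    finite_galois_ext L (tensor_ring k E i L j) (pure_tensor k E i L j \<one>\<^bsub>E\<^esub>) \<and>
    galois_group L (tensor_ring k E i L j) (pure_tensor k E i L j \<one>\<^bsub>E\<^esub>) \<cong> G"

text \<open>HOL cannot quantify over types inside a formula, so the type in which the auxiliary
  field \<open>L\<close> lives is a parameter. Statements about pre-Galois groups should be made for
  arbitrary, independent instances of it.\<close>

definition is_pre_galois_group ::
    "'l itself \<Rightarrow> ('k, 'p) ring_scheme \<Rightarrow> ('e, 'q) ring_scheme \<Rightarrow> ('k \<Rightarrow> 'e) \<Rightarrow>
     ('g, 'm) monoid_scheme \<Rightarrow> bool"
  where "is_pre_galois_group _ k E i G \<longleftrightarrow>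
    finite_field_ext k E i \<and> group G \<and>
    (\<exists>(L :: 'l ring) j. pre_galois_via k E i L j G)"

end

theory Submission
  imports Defs
begin

text \<open>Two normal complements \<open>N\<close>, \<open>V\<close> of \<open>U\<close> with \<open>N\<close> simple either coincide or intersect trivially.
  In the latter case they commute elementwise, and \<open>n = v u \<mapsto> v\<^sup>-\<^sup>1\<close> is an isomorphism from \<open>N\<close> to \<open>V\<close>.

  For the second part, let \<open>A\<^sub>1 = E \<otimes> L\<^sub>1\<close> and \<open>A\<^sub>2 = E \<otimes> L\<^sub>2\<close> be two Galois base changes of \<open>E\<close>, embedded
  over \<open>E\<close> into an algebraic closure of \<open>E\<close>. The field \<open>M = A\<^sub>1 \<inter> A\<^sub>2\<close> contains \<open>E\<close> and is stable under
  embeddings over \<open>k\<close>. Restriction to \<open>M\<close> embeds both \<open>Gal(A\<^sub>1/L\<^sub>1)\<close> and \<open>Gal(A\<^sub>2/L\<^sub>2)\<close> into \<open>Aut(M/k)\<close> as normal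
  complements of \<open>Aut(M/E)\<close>: each acts simply transitively on the embeddings of \<open>E\<close> over \<open>k\<close>. No dimension
  count is needed: by Dedekind's independence of characters, applied to the trace, any two homomorphisms
  on a Galois extension which agree on the base field differ by an automorphism.\<close>

section \<open>Normal complements\<close>

text \<open>The auxiliary fields of the two base changes may live in unrelated types and share
  nothing visible except k, so the two Galois groups have no evident common overgroup. Fixing a
  single embedding of E into the algebraic closure forces the two images to overlap in at least E.
  The intersection M is preferred to a compositum because automorphisms restrict to M canonically,
  whereas lifting them to a compositum would require choices. Nothing is lost by restricting: an
  element of Gal(A/L) fixes L, and A is generated by E and L, so its values on E determine it. What
  makes A behave like a normal extension of k is the action of Gal(L/k) on the second tensor factor.
  The automorphism \<open>1 \<otimes> \<sigma>\<close> changes a map on L without disturbing it on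
  E. This one correction yields the stability of M and the transitivity on E. Normality of the
  complements comes from the companion fact that automorphisms of M over k lift to automorphisms of
  A which preserve L.\<close>

lemma (in group) complement_ofD:
  assumes "complement_of G U V"
  shows "\<And>x. x \<in> carrier G \<Longrightarrow> \<exists>v\<in>V. \<exists>u\<in>U. x = v \<otimes> u"
    and "V \<inter> U = {\<one>}"
proof -
  have U: "subgroup U G" and V: "subgroup V G"
    and ex1: "\<And>x. x \<in> carrier G \<Longrightarrow> \<exists>!p. p \<in> V \<times> U \<and> x = fst p \<otimes> snd p"
    using assms by (auto simp: complement_of_def)
  show "\<exists>v\<in>V. \<exists>u\<in>U. x = v \<otimes> u" if x: "x \<in> carrier G" for x
  proof -
    obtain p where "p \<in> V \<times> U \<and> x = fst p \<otimes> snd p"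
      using ex1[OF x] by (rule ex1E)
    then show ?thesis by (auto simp: mem_Times_iff)
  qed
  have "x = \<one>" if "x \<in> V" "x \<in> U" for x
  proof -
    have "x \<in> carrier G" using subgroup.mem_carrier[OF V that(1)] .
    moreover have "(x, \<one>) \<in> V \<times> U" "(\<one>, x) \<in> V \<times> U"
      using that U V by (auto simp: subgroup.one_closed)
    moreover have "x = fst (x, \<one>) \<otimes> snd (x, \<one>)" "x = fst (\<one>, x) \<otimes> snd (\<one>, x)"
      using \<open>x \<in> carrier G\<close> by simp_all
    ultimately have "(x, \<one>) = (\<one>, x)"
      using ex1[of x] by blast
    thus ?thesis by blast
  qed
  thus "V \<inter> U = {\<one>}"
    using subgroup.one_closed[OF U] subgroup.one_closed[OF V] by blast
qed

lemma (in group) complement_ofI: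
  assumes U: "subgroup U G" and V: "subgroup V G"
    and ex: "\<And>x. x \<in> carrier G \<Longrightarrow> \<exists>v\<in>V. \<exists>u\<in>U. x = v \<otimes> u"
    and int: "V \<inter> U \<subseteq> {\<one>}"
  shows "complement_of G U V"
  unfolding complement_of_def
proof (intro conjI U V ballI)
  fix x assume "x \<in> carrier G"
  then obtain v u where vu: "v \<in> V" "u \<in> U" "x = v \<otimes> u" using ex by blast
  show "\<exists>!p. p \<in> V \<times> U \<and> x = fst p \<otimes> snd p"
  proof (rule ex1I[of _ "(v, u)"])
    fix p assume "p \<in> V \<times> U \<and> x = fst p \<otimes> snd p"
    then obtain v' u' where p: "p = (v', u')" "v' \<in> V" "u' \<in> U" "v \<otimes> u = v' \<otimes> u'"
      using vu by (cases p) auto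
    note [simp] = subgroup.mem_carrier[OF V] subgroup.mem_carrier[OF U]
    have c: "v \<in> carrier G" "u \<in> carrier G" "v' \<in> carrier G" "u' \<in> carrier G"
      using vu p by auto
    have "inv v' \<otimes> v = u' \<otimes> inv u"
      using c p(4) by (metis inv_solve_left inv_solve_right m_assoc m_closed inv_closed)
    moreover have "inv v' \<otimes> v \<in> V" "u' \<otimes> inv u \<in> U"
      using vu p U V by (auto intro: subgroup.m_closed subgroup.m_inv_closed)
    ultimately have "inv v' \<otimes> v = \<one>" "u' \<otimes> inv u = \<one>" using int by auto
    then have "v = v'" "u = u'"
      using c by (metis inv_closed inv_equality inv_inv)+
    then show "p = (v, u)" using p by simp
  qed (use vu in auto)
qed

text \<open>Writing v in V as n u with n in N leaves the remainder u = n^-1 v, which lies in V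
  because N does, and hence in the trivial intersection of V and U. A comparison of orders would say
  nothing for infinite groups.\<close>

lemma (in group) complement_eqI:
  assumes N: "complement_of G U N" and V: "complement_of G U V" and "N \<subseteq> V"
  shows "N = V"
proof
  have sU: "subgroup U G" and sN: "subgroup N G" and sV: "subgroup V G"
    using N V by (auto simp: complement_of_def)
  note [simp] = subgroup.mem_carrier[OF sV] subgroup.mem_carrier[OF sU] subgroup.mem_carrier[OF sN]
  show "V \<subseteq> N"
  proof
    fix v assume v: "v \<in> V"
    then obtain n u where nu: "n \<in> N" "u \<in> U" "v = n \<otimes> u"
      using complement_ofD(1)[OF N, of v] by auto
    then have u: "u = inv n \<otimes> v" using v by (simp add: inv_solve_left)
    have "inv n \<otimes> v \<in> V" using nu v \<open>N \<subseteq> V\<close> sV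
      by (auto intro: subgroup.m_closed subgroup.m_inv_closed)
    then have "u \<in> V \<inter> U" using nu(2) by (metis IntI u)
    then have "u = \<one>" using complement_ofD(2)[OF V] by simp
    then show "v \<in> N" using nu(1,3) by simp
  qed
qed fact

text \<open>N and V are both transversals of the left cosets of U, so passing from n to the
  representative of its coset in V is a bijection. The trivial intersection is what makes it
  compatible with products.\<close>

lemma (in group) normal_complements_disjoint_iso:
  assumes N: "normal_complement_of G U N" and V: "normal_complement_of G U V"
    and int: "N \<inter> V = {\<one>}"
  shows "G\<lparr>carrier := N\<rparr> \<cong> G\<lparr>carrier := V\<rparr>"
proof -
  have sU: "subgroup U G" and sN: "subgroup N G" and sV: "subgroup V G"
    and cN: "complement_of G U N" and cV: "complement_of G U V"
    and nN: "N \<lhd> G" and nV: "V \<lhd> G"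
    using N V by (auto simp: complement_of_def normal_complement_of_def)
  note mem = subgroup.mem_carrier[OF sV] subgroup.mem_carrier[OF sU] subgroup.mem_carrier[OF sN]
  have comm: "n \<otimes> v = v \<otimes> n" if "n \<in> N" "v \<in> V" for n v
  proof -
    have c: "n \<in> carrier G" "v \<in> carrier G" using that mem by auto
    \<comment> \<open>The commutator is read in two ways: its first three factors form a conjugate
      of v, which puts it in V, while its last three form a conjugate of n^-1, which puts it in
      N.\<close>
    let ?c = "n \<otimes> v \<otimes> inv n \<otimes> inv v"
    have "n \<otimes> v \<otimes> inv n \<in> V" using normal.inv_op_closed2[OF nV c(1) that(2)] .
    then have "?c \<in> V" using sV that by (auto intro: subgroup.m_closed subgroup.m_inv_closed)
    moreover have "v \<otimes> inv n \<otimes> inv v \<in> N"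
      using normal.inv_op_closed2[OF nN c(2) subgroup.m_inv_closed[OF sN that(1)]] .
    then have "n \<otimes> (v \<otimes> inv n \<otimes> inv v) \<in> N"
      using sN that by (auto intro: subgroup.m_closed)
    then have "?c \<in> N" using c by (simp add: m_assoc)
    ultimately have "?c = \<one>" using int by auto
    then have "(n \<otimes> v) \<otimes> inv (v \<otimes> n) = \<one>" using c by (simp add: m_assoc inv_mult_group)
    then show ?thesis using c by (metis inv_equality inv_inv m_closed inv_closed)
  qed
  \<comment> \<open>The factor \<open>v\<close> of \<open>n = v u\<close> depends anti-multiplicatively on \<open>n\<close>, because \<open>N\<close> and \<open>V\<close> commute;
    its inverse is characterised by \<open>v\<^sup>-\<^sup>1 n \<in> U\<close>.\<close>
  define f where "f n = (THE v. v \<in> V \<and> v \<otimes> n \<in> U)" for n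
  have uniq: "v = v'" if "v \<in> V" "v' \<in> V" "v \<otimes> n \<in> U" "v' \<otimes> n \<in> U" "n \<in> carrier G" for v v' n
  proof -
    have c: "v \<in> carrier G" "v' \<in> carrier G" using that mem by auto
    have "(v \<otimes> n) \<otimes> inv (v' \<otimes> n) \<in> U" using that sU by (auto intro: subgroup.m_closed subgroup.m_inv_closed)
    moreover have "n \<otimes> (inv n \<otimes> inv v') = inv v'" using c that by (simp add: m_assoc[symmetric])
    then have "(v \<otimes> n) \<otimes> inv (v' \<otimes> n) = v \<otimes> inv v'" using c that by (simp add: inv_mult_group m_assoc)
    ultimately have "v \<otimes> inv v' \<in> U" by simp
    moreover have "v \<otimes> inv v' \<in> V" using that sV by (auto intro: subgroup.m_closed subgroup.m_inv_closed)
    ultimately have "v \<otimes> inv v' = \<one>" using complement_ofD(2)[OF cV] by auto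
    then show ?thesis using c by (metis inv_closed inv_equality inv_inv)
  qed
  have f: "f n \<in> V \<and> f n \<otimes> n \<in> U" if "n \<in> carrier G" for n
  proof -
    obtain v u where vu: "v \<in> V" "u \<in> U" "n = v \<otimes> u" using complement_ofD(1)[OF cV \<open>n \<in> carrier G\<close>] by auto
    then have "inv v \<otimes> n = u" using mem by (simp add: m_assoc[symmetric])
    then have "inv v \<in> V \<and> inv v \<otimes> n \<in> U" using vu sV by (auto intro: subgroup.m_inv_closed)
    then show ?thesis unfolding f_def by (rule theI) (use uniq that \<open>inv v \<in> V \<and> _\<close> in blast)
  qed
  have feq: "f n = v" if "n \<in> carrier G" "v \<in> V" "v \<otimes> n \<in> U" for n v
    using f[OF that(1)] that uniq by blast
  have "f \<in> iso (G\<lparr>carrier := N\<rparr>) (G\<lparr>carrier := V\<rparr>)"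
  proof (rule isoI)
    show "f \<in> hom (G\<lparr>carrier := N\<rparr>) (G\<lparr>carrier := V\<rparr>)"
    proof (rule homI)
      fix n n' assume "n \<in> carrier (G\<lparr>carrier := N\<rparr>)" "n' \<in> carrier (G\<lparr>carrier := N\<rparr>)"
      then have n: "n \<in> N" "n' \<in> N" by auto
      then have c: "n \<in> carrier G" "n' \<in> carrier G" using mem by auto
      note fn = f[OF c(1)] f[OF c(2)]
      then have c': "f n \<in> carrier G" "f n' \<in> carrier G" using mem by auto
      \<comment> \<open>Regrouping moves n past \<open>f n'\<close>, which is allowed because
        \<open>f n'\<close> lies in V.\<close>
      have "(f n \<otimes> f n') \<otimes> (n \<otimes> n') = (f n \<otimes> n) \<otimes> (f n' \<otimes> n')"
        using c c' comm[OF n(1), of "f n'"] fn by (metis m_assoc m_closed)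
      also have "\<dots> \<in> U" using fn sU by (auto intro: subgroup.m_closed)
      finally have "f (n \<otimes> n') = f n \<otimes> f n'"
        using fn c sV by (intro feq) (auto intro: subgroup.m_closed)
      then show "f (n \<otimes>\<^bsub>G\<lparr>carrier := N\<rparr>\<^esub> n') = f n \<otimes>\<^bsub>G\<lparr>carrier := V\<rparr>\<^esub> f n'" by simp
    qed (use f mem in auto)
    show "bij_betw f (carrier (G\<lparr>carrier := N\<rparr>)) (carrier (G\<lparr>carrier := V\<rparr>))"
    proof (rule bij_betw_imageI)
      show "inj_on f (carrier (G\<lparr>carrier := N\<rparr>))"
      proof (rule inj_onI)
        fix n n' assume "n \<in> carrier (G\<lparr>carrier := N\<rparr>)" "n' \<in> carrier (G\<lparr>carrier := N\<rparr>)" and eq: "f n = f n'"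
        then have n: "n \<in> N" "n' \<in> N" by auto
        then have c: "n \<in> carrier G" "n' \<in> carrier G" using mem by auto
        have fc: "f n \<in> carrier G" using f[OF c(1)] mem by auto
        have "inv (f n \<otimes> n) \<otimes> (f n' \<otimes> n') \<in> U"
          using f[OF c(1)] f[OF c(2)] sU by (auto intro: subgroup.m_closed subgroup.m_inv_closed)
        also have "inv (f n \<otimes> n) \<otimes> (f n' \<otimes> n') = inv n \<otimes> n'"
        proof -
          have "inv (f n) \<otimes> (f n \<otimes> n') = n'" using c fc by (simp add: m_assoc[symmetric])
          then show ?thesis using c fc eq by (simp add: inv_mult_group m_assoc)
        qed
        finally have "inv n \<otimes> n' \<in> N \<inter> U"
          using n sN by (auto intro: subgroup.m_closed subgroup.m_inv_closed)
        then have "inv n \<otimes> n' = \<one>" using complement_ofD(2)[OF cN] by auto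
        then show "n = n'" using c by (metis inv_closed inv_equality inv_inv)
      qed
      show "f ` carrier (G\<lparr>carrier := N\<rparr>) = carrier (G\<lparr>carrier := V\<rparr>)"
      proof
        show "f ` carrier (G\<lparr>carrier := N\<rparr>) \<subseteq> carrier (G\<lparr>carrier := V\<rparr>)" using f mem by auto
        show "carrier (G\<lparr>carrier := V\<rparr>) \<subseteq> f ` carrier (G\<lparr>carrier := N\<rparr>)"
        proof
          fix v assume "v \<in> carrier (G\<lparr>carrier := V\<rparr>)"
          then have v: "v \<in> V" by simp
          then have vc: "v \<in> carrier G" using mem by auto
          \<comment> \<open>The preimage of v is the N-part of v^-1: from v^-1 = n u follows v n =
            u^-1, an element of U.\<close>
          then obtain n u where nu: "n \<in> N" "u \<in> U" "inv v = n \<otimes> u"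
            using complement_ofD(1)[OF cN, of "inv v"] by auto
          then have c: "n \<in> carrier G" "u \<in> carrier G" using mem by auto
          have "v \<otimes> n = inv u"
          proof -
            have "v = inv u \<otimes> inv n" using nu(3) vc c by (metis inv_inv inv_mult_group)
            then show ?thesis using c by (simp add: m_assoc)
          qed
          then have "v \<otimes> n \<in> U" using nu sU by (auto intro: subgroup.m_inv_closed)
          then have "f n = v" using feq c v by auto
          then show "v \<in> f ` carrier (G\<lparr>carrier := N\<rparr>)" using nu by auto
        qed
      qed
    qed
  qed
  then show ?thesis by (auto simp: is_iso_def)
qed

theorem (in group) simple_normal_complement_unique:
  assumes S: "simple_group S" and N: "normal_complement_of G U N" and iso: "G\<lparr>carrier := N\<rparr> \<cong> S"
    and V: "normal_complement_of G U V"
  shows "G\<lparr>carrier := V\<rparr> \<cong> S"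
proof -
  have cN: "complement_of G U N" and cV: "complement_of G U V" and nN: "N \<lhd> G" and nV: "V \<lhd> G"
    using N V unfolding normal_complement_of_def by simp_all
  have sN: "subgroup N G" using normal_imp_subgroup[OF nN] .
  have gN: "group (G\<lparr>carrier := N\<rparr>)" using subgroup.subgroup_is_group[OF sN group_axioms] .
  obtain \<phi> where "\<phi> \<in> iso S (G\<lparr>carrier := N\<rparr>)"
    using group.iso_sym[OF gN iso] unfolding is_iso_def by blast
  \<comment> \<open>Simplicity is moved from S to N itself, since the normal subgroup to be tested
    is a subgroup of N.\<close>
  then have simple: "simple_group (G\<lparr>carrier := N\<rparr>)"
    using simple_group.iso_simple[OF S gN] by simp
  have "N \<inter> V \<lhd> G\<lparr>carrier := N\<rparr>"
    using normal_Int_subgroup[OF sN nV] by (simp only: Int_commute)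
  then have "N \<inter> V = N \<or> N \<inter> V = {\<one>}"
    using simple_group.no_real_normal_subgroup[OF simple] by simp
  then show ?thesis
  proof
    assume "N \<inter> V = N"
    then have "N = V" using complement_eqI[OF cN cV] by blast
    then show ?thesis using iso by simp
  next
    assume "N \<inter> V = {\<one>}"
    then have "G\<lparr>carrier := V\<rparr> \<cong> G\<lparr>carrier := N\<rparr>"
      using normal_complements_disjoint_iso[OF N V] group.iso_sym[OF gN] by simp
    then show ?thesis using iso by (rule iso_trans)
  qed
qed

section \<open>Extension of homomorphisms into algebraically closed fields\<close>

lemma (in algebraically_closed) exists_root_of_nonconstant:
  assumes "p \<in> carrier (poly_ring L)" and "degree p > 0"
  obtains b where "b \<in> carrier L" and "eval p b = \<zero>"
proof -
  have "size (roots p) > 0"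
    using roots_over_carrier[OF assms(1)] assms(2) by (simp add: splitted_def)
  then obtain b where "b \<in># roots p" by (metis nonempty_has_size multiset_nonemptyE)
  then have "is_root p b" using roots_mem_iff_is_root[OF assms(1)] by simp
  then show ?thesis using that by (auto simp: is_root_def)
qed

text \<open>Evaluation at x identifies K[x] with K[X] modulo the minimal polynomial p of x. If b is
  a root in \<open>\<Omega>\<close> of the image of p under \<open>\<phi>\<close>, then applying
  \<open>\<phi>\<close> to coefficients and evaluating at b kills p, so this map factors through
  K[x].\<close>

lemma extend_hom_simple_extension:
  assumes A: "field A" and \<Omega>: "algebraically_closed \<Omega>" and K: "subfield K A" and x: "x \<in> carrier A"
    and alg: "(ring.algebraic A over K) x" and \<phi>: "\<phi> \<in> ring_hom (A\<lparr>carrier := K\<rparr>) \<Omega>"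
  obtains \<psi> where "\<psi> \<in> ring_hom (A\<lparr>carrier := ring.simple_extension A K x\<rparr>) \<Omega>"
    and "\<And>a. a \<in> K \<Longrightarrow> \<psi> a = \<phi> a"
proof -
  interpret A: field A by fact
  interpret \<Omega>: algebraically_closed \<Omega> by fact
  have sub: "subring K A" using subfieldE(1)[OF K] .
  have fK: "field (A\<lparr>carrier := K\<rparr>)" using A.subfield_iff(2)[OF K] .
  have polyK: "poly_ring (A\<lparr>carrier := K\<rparr>) = K[X]\<^bsub>A\<^esub>"
    using A.univ_poly_consistent[OF sub] by simp
  interpret \<Phi>: ring_hom_ring "A\<lparr>carrier := K\<rparr>" \<Omega> \<phi>
    using ring_hom_ringI2[OF field.is_ring[OF fK] \<Omega>.is_ring \<phi>] .
  interpret UP: domain "K[X]\<^bsub>A\<^esub>" using A.univ_poly_is_domain[OF sub] .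
  define p where "p = A.Irr K x"
  note p = A.IrrE[OF K x alg, folded p_def]
  have mapp: "map \<phi> q \<in> carrier (poly_ring \<Omega>)" if "q \<in> carrier (K[X]\<^bsub>A\<^esub>)" for q
    using polynomial_hom[OF \<phi> fK \<Omega>.field_axioms] that polyK by simp
  have "degree p \<ge> 1" using A.pirreducible_degree[OF K p(1,2)] .
  then have "degree (map \<phi> p) > 0" by simp
  then obtain b where b: "b \<in> carrier \<Omega>" "\<Omega>.eval (map \<phi> p) b = \<zero>\<^bsub>\<Omega>\<^esub>"
    using \<Omega>.exists_root_of_nonconstant[OF mapp[OF p(1)]] by blast
  define \<Theta> where "\<Theta> q = \<Omega>.eval (map \<phi> q) b" for q
  have setK: "set q \<subseteq> K" if "q \<in> carrier (K[X]\<^bsub>A\<^esub>)" for q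
    using that unfolding sym[OF univ_poly_carrier] polynomial_def by auto
  have set\<Omega>: "set (map \<phi> q) \<subseteq> carrier \<Omega>" if "set q \<subseteq> K" for q
    using that \<Phi>.hom_closed by auto
  have \<Theta>: "\<Theta> \<in> ring_hom (K[X]\<^bsub>A\<^esub>) \<Omega>"
  proof (rule ring_hom_memI)
    fix q r assume q: "q \<in> carrier (K[X]\<^bsub>A\<^esub>)" and r: "r \<in> carrier (K[X]\<^bsub>A\<^esub>)"
    note qr = setK[OF q] setK[OF r]
    \<comment> \<open>Mapping coefficients commutes with polynomial operations only up to removal of
      leading zeros; evaluation does not see the difference, so a \<open>normalize\<close> may be
      inserted.\<close>
    have "\<Theta> (q \<otimes>\<^bsub>K[X]\<^bsub>A\<^esub>\<^esub> r) = \<Omega>.eval (\<Omega>.normalize (map \<phi> (ring.poly_mult (A\<lparr>carrier := K\<rparr>) q r))) b"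
      using \<Omega>.eval_normalize[OF set\<Omega> b(1)] setK[OF UP.m_closed[OF q r]]
      unfolding \<Theta>_def univ_poly_mult A.poly_mult_consistent[OF sub] by simp
    also have "\<dots> = \<Omega>.eval (\<Omega>.poly_mult (map \<phi> q) (map \<phi> r)) b"
      using \<Phi>.poly_mult_hom'[of q r] qr by simp
    also have "\<dots> = \<Theta> q \<otimes>\<^bsub>\<Omega>\<^esub> \<Theta> r"
      using \<Omega>.eval_poly_mult[OF set\<Omega>[OF qr(1)] set\<Omega>[OF qr(2)] b(1)] unfolding \<Theta>_def .
    finally show "\<Theta> (q \<otimes>\<^bsub>K[X]\<^bsub>A\<^esub>\<^esub> r) = \<Theta> q \<otimes>\<^bsub>\<Omega>\<^esub> \<Theta> r" .
    have "\<Theta> (q \<oplus>\<^bsub>K[X]\<^bsub>A\<^esub>\<^esub> r) = \<Omega>.eval (\<Omega>.normalize (map \<phi> (ring.poly_add (A\<lparr>carrier := K\<rparr>) q r))) b"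
      using \<Omega>.eval_normalize[OF set\<Omega> b(1)] setK[OF UP.a_closed[OF q r]]
      unfolding \<Theta>_def univ_poly_add A.poly_add_consistent[OF sub] by simp
    also have "\<dots> = \<Omega>.eval (\<Omega>.poly_add (map \<phi> q) (map \<phi> r)) b"
      using \<Phi>.poly_add_hom'[of q r] qr by simp
    also have "\<dots> = \<Theta> q \<oplus>\<^bsub>\<Omega>\<^esub> \<Theta> r"
      using \<Omega>.eval_poly_add[OF set\<Omega>[OF qr(1)] set\<Omega>[OF qr(2)] b(1)] unfolding \<Theta>_def .
    finally show "\<Theta> (q \<oplus>\<^bsub>K[X]\<^bsub>A\<^esub>\<^esub> r) = \<Theta> q \<oplus>\<^bsub>\<Omega>\<^esub> \<Theta> r" .
    show "\<Theta> q \<in> carrier \<Omega>" unfolding \<Theta>_def using \<Omega>.eval_in_carrier[OF set\<Omega>[OF qr(1)] b(1)] .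
  next
    show "\<Theta> \<one>\<^bsub>K[X]\<^bsub>A\<^esub>\<^esub> = \<one>\<^bsub>\<Omega>\<^esub>" unfolding \<Theta>_def univ_poly_one using \<Phi>.hom_one b by simp
  qed
  interpret \<Theta>: ring_hom_ring "K[X]\<^bsub>A\<^esub>" \<Omega> \<Theta>
    using ring_hom_ringI2[OF UP.ring_axioms \<Omega>.is_ring \<Theta>] .
  interpret ev: ring_hom_ring "K[X]\<^bsub>A\<^esub>" A "\<lambda>q. A.eval q x"
    using A.eval_ring_hom[OF sub x] .
  have ker: "\<Theta> q = \<zero>\<^bsub>\<Omega>\<^esub>" if "q \<in> carrier (K[X]\<^bsub>A\<^esub>)" "A.eval q x = \<zero>\<^bsub>A\<^esub>" for q
  proof -
    have "q \<in> PIdl\<^bsub>K[X]\<^bsub>A\<^esub>\<^esub> p"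
      using A.Irr_generates_ker[OF K x alg] that unfolding a_kernel_def' p_def by blast
    then obtain r where "r \<in> carrier (K[X]\<^bsub>A\<^esub>)" "q = r \<otimes>\<^bsub>K[X]\<^bsub>A\<^esub>\<^esub> p"
      unfolding cgenideal_def by blast
    then show ?thesis using p(1) b(2) \<Theta>.hom_mult by (simp add: \<Theta>_def[of p, symmetric])
  qed
  have wd: "\<Theta> q = \<Theta> r" if "q \<in> carrier (K[X]\<^bsub>A\<^esub>)" "r \<in> carrier (K[X]\<^bsub>A\<^esub>)" "A.eval q x = A.eval r x" for q r
  proof -
    have "A.eval (q \<ominus>\<^bsub>K[X]\<^bsub>A\<^esub>\<^esub> r) x = \<zero>\<^bsub>A\<^esub>"
      using that ev.hom_closed[OF that(2)] by (simp add: a_minus_def) (simp add: A.r_neg)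
    then have "\<Theta> (q \<ominus>\<^bsub>K[X]\<^bsub>A\<^esub>\<^esub> r) = \<zero>\<^bsub>\<Omega>\<^esub>" using ker that by simp
    then have "\<Theta> q \<ominus>\<^bsub>\<Omega>\<^esub> \<Theta> r = \<zero>\<^bsub>\<Omega>\<^esub>" using that by (simp add: a_minus_def)
    then show ?thesis using that by simp
  qed
  \<comment> \<open>An arbitrary polynomial expression for y; by \<open>wd\<close> the value of
    \<open>\<Theta>\<close> does not depend on the choice.\<close>
  define c where "c y = (SOME q. q \<in> carrier (K[X]\<^bsub>A\<^esub>) \<and> A.eval q x = y)" for y
  have img: "A.simple_extension K x = (\<lambda>q. A.eval q x) ` carrier (K[X]\<^bsub>A\<^esub>)"
    using A.simple_extension_as_eval_img[OF subringE(1)[OF sub] x] .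
  have c: "c y \<in> carrier (K[X]\<^bsub>A\<^esub>) \<and> A.eval (c y) x = y" if "y \<in> A.simple_extension K x" for y
    unfolding c_def by (rule someI_ex) (use that img in auto)
  have sr: "subring (A.simple_extension K x) A" using A.simple_extension_is_subring[OF sub x] .
  have \<psi>eq: "\<Theta> (c (A.eval q x)) = \<Theta> q" if "q \<in> carrier (K[X]\<^bsub>A\<^esub>)" for q
    using wd[of "c (A.eval q x)" q] c[of "A.eval q x"] that img by blast
  show ?thesis
  proof (rule that[of "\<lambda>y. \<Theta> (c y)"])
    show "(\<lambda>y. \<Theta> (c y)) \<in> ring_hom (A\<lparr>carrier := A.simple_extension K x\<rparr>) \<Omega>"
    proof (rule ring_hom_memI)
      fix y z assume "y \<in> carrier (A\<lparr>carrier := A.simple_extension K x\<rparr>)" "z \<in> carrier (A\<lparr>carrier := A.simple_extension K x\<rparr>)"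
      then have y: "y \<in> A.simple_extension K x" and z: "z \<in> A.simple_extension K x" by auto
      show "\<Theta> (c y) \<in> carrier \<Omega>" using c[OF y] by simp
      show "\<Theta> (c (y \<otimes>\<^bsub>A\<lparr>carrier := A.simple_extension K x\<rparr>\<^esub> z)) = \<Theta> (c y) \<otimes>\<^bsub>\<Omega>\<^esub> \<Theta> (c z)"
        using \<psi>eq[of "c y \<otimes>\<^bsub>K[X]\<^bsub>A\<^esub>\<^esub> c z"] c[OF y] c[OF z] by simp
      show "\<Theta> (c (y \<oplus>\<^bsub>A\<lparr>carrier := A.simple_extension K x\<rparr>\<^esub> z)) = \<Theta> (c y) \<oplus>\<^bsub>\<Omega>\<^esub> \<Theta> (c z)"
        using \<psi>eq[of "c y \<oplus>\<^bsub>K[X]\<^bsub>A\<^esub>\<^esub> c z"] c[OF y] c[OF z] by simp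
    next
      show "\<Theta> (c \<one>\<^bsub>A\<lparr>carrier := A.simple_extension K x\<rparr>\<^esub>) = \<one>\<^bsub>\<Omega>\<^esub>"
        using \<psi>eq[OF UP.one_closed] by simp
    qed
  next
    fix a assume a: "a \<in> K"
    show "\<Theta> (c a) = \<phi> a"
    proof -
      have aA: "a \<in> carrier A" using a subringE(1)[OF sub] by blast
      \<comment> \<open>The constant polynomial a has to be normalised because zero is represented
        by the empty list.\<close>
      have q: "A.normalize [a] \<in> carrier (K[X]\<^bsub>A\<^esub>)"
        using a subringE(2)[OF sub] unfolding sym[OF univ_poly_carrier] polynomial_def by auto
      have ev: "A.eval (A.normalize [a]) x = a" using A.eval_normalize[of "[a]" x] aA x by simp
      have "\<Theta> (A.normalize [a]) = \<phi> a"
        using a \<Phi>.hom_closed[of a] \<Phi>.hom_zero b(1) by (auto simp: \<Theta>_def)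
      then show ?thesis using \<psi>eq[OF q] ev by simp
    qed
  qed
qed

lemma extend_hom_finite_extension:
  assumes A: "field A" and \<Omega>: "algebraically_closed \<Omega>" and K: "subfield K A"
    and xs: "set xs \<subseteq> carrier A" "\<And>x. x \<in> set xs \<Longrightarrow> (ring.algebraic A over K) x"
    and \<phi>: "\<phi> \<in> ring_hom (A\<lparr>carrier := K\<rparr>) \<Omega>"
  shows "\<exists>\<psi>. \<psi> \<in> ring_hom (A\<lparr>carrier := ring.finite_extension A K xs\<rparr>) \<Omega> \<and> (\<forall>a\<in>K. \<psi> a = \<phi> a)"
  using xs
proof (induction xs)
  case Nil
  have "ring.finite_extension A K [] = K"
    using field.is_ring[OF A] by (simp add: ring.finite_extension.simps)
  then show ?case using \<phi> by auto
next
  interpret A: field A by fact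
  case (Cons x xs)
  then obtain \<psi> where \<psi>: "\<psi> \<in> ring_hom (A\<lparr>carrier := A.finite_extension K xs\<rparr>) \<Omega>" "\<forall>a\<in>K. \<psi> a = \<phi> a"
    by auto
  have sf: "subfield (A.finite_extension K xs) A"
    using A.finite_extension_is_subfield[OF K] Cons.prems by auto
  have incl: "K \<subseteq> A.finite_extension K xs"
    using A.finite_extension_incl[OF subfieldE(3)[OF K]] Cons.prems by auto
  then have "(A.algebraic over A.finite_extension K xs) x"
    using A.algebraic_mono Cons.prems by (auto simp: over_def)
  then obtain \<psi>' where "\<psi>' \<in> ring_hom (A\<lparr>carrier := A.simple_extension (A.finite_extension K xs) x\<rparr>) \<Omega>"
    "\<And>a. a \<in> A.finite_extension K xs \<Longrightarrow> \<psi>' a = \<psi> a"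
    using extend_hom_simple_extension[OF A \<Omega> sf _ _ \<psi>(1)] Cons.prems by (metis insert_subset list.set(2))
  then show ?case using \<psi>(2) incl by (intro exI[of _ \<psi>']) auto
qed

text \<open>A spanning list of A over F is algebraic over the larger field K and generates A over
  it, so finitely many simple extensions lead from K to A. Two fields are kept apart because the
  dimension is known over F, the image of k, while the map is given on K: the copy of E when the
  embedding of A is built, the preimage of M when maps on M are lifted.\<close>

lemma extend_hom_finite_dimension:
  assumes A: "field A" and \<Omega>: "algebraically_closed \<Omega>"
    and F: "subfield F A" and fin: "ring.finite_dimension A F (carrier A)"
    and K: "subfield K A" and FK: "F \<subseteq> K" and \<phi>: "\<phi> \<in> ring_hom (A\<lparr>carrier := K\<rparr>) \<Omega>"
  obtains \<psi> where "\<psi> \<in> ring_hom A \<Omega>" and "\<And>a. a \<in> K \<Longrightarrow> \<psi> a = \<phi> a"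
proof -
  interpret A: field A by fact
  obtain n where "A.dimension n F (carrier A)" using fin by (auto simp: A.finite_dimension_def)
  then obtain xs where xs: "set xs \<subseteq> carrier A" "A.Span F xs = carrier A"
    using A.exists_base[OF F] by blast
  have "(A.algebraic over F) x" if "x \<in> carrier A" for x
    using A.finite_dimension_imp_algebraic[OF F A.carrier_is_subring fin that] .
  then have algK: "(A.algebraic over K) x" if "x \<in> set xs" for x
    using A.algebraic_mono[OF FK] xs that by (auto simp: over_def)
  have sf: "subfield (A.finite_extension K xs) A"
    using A.finite_extension_is_subfield[OF K xs(1)] algK by blast
  \<comment> \<open>The field generated by xs over K is an F-subspace containing xs, hence contains
    the F-span of xs, which is A.\<close>
  have "subgroup (A.finite_extension K xs) (add_monoid A)"
    using subring.axioms(1)[OF subfieldE(1)[OF sf]] .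
  moreover have "a \<otimes>\<^bsub>A\<^esub> v \<in> A.finite_extension K xs" if "a \<in> F" "v \<in> A.finite_extension K xs" for a v
    using subringE(6)[OF subfieldE(1)[OF sf]] that FK A.finite_extension_incl[OF subfieldE(3)[OF K] xs(1)] by blast
  ultimately have "subalgebra F (A.finite_extension K xs) A"
    by (simp add: subalgebra_def subalgebra_axioms_def)
  then have "A.Span F xs \<subseteq> A.finite_extension K xs"
    using A.subalgebra_Span_incl[OF F] A.finite_extension_mem[OF subfieldE(1)[OF K] xs(1)] by blast
  then have "A.finite_extension K xs = carrier A"
    using xs(2) subfieldE(3)[OF sf] by blast
  then show ?thesis
    using extend_hom_finite_extension[OF A \<Omega> K xs(1) algK \<phi>] that by auto
qed

section \<open>Galois groups and independence of characters\<close>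

lemma carrier_galois_group:
  "\<sigma> \<in> carrier (galois_group k E i) \<longleftrightarrow>
    \<sigma> \<in> Bij (carrier E) \<and> \<sigma> \<in> ring_hom E E \<and> (\<forall>a \<in> carrier k. \<sigma> (i a) = i a)"
  by (simp add: galois_group_def)

lemma galois_groupD:
  assumes "\<sigma> \<in> carrier (galois_group k E i)"
  shows "\<sigma> \<in> ring_hom E E" "\<sigma> \<in> extensional (carrier E)" "bij_betw \<sigma> (carrier E) (carrier E)"
    "\<And>x. x \<in> carrier E \<Longrightarrow> \<sigma> x \<in> carrier E" "\<And>a. a \<in> carrier k \<Longrightarrow> \<sigma> (i a) = i a"
  using assms by (auto simp: carrier_galois_group Bij_def bij_betw_def)

lemma one_galois_group: "\<one>\<^bsub>galois_group k E i\<^esub> = (\<lambda>x \<in> carrier E. x)"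
  by (simp add: galois_group_def BijGroup_def)

lemma mult_galois_group:
  assumes "\<sigma> \<in> carrier (galois_group k E i)" "\<tau> \<in> carrier (galois_group k E i)"
  shows "\<sigma> \<otimes>\<^bsub>galois_group k E i\<^esub> \<tau> = compose (carrier E) \<sigma> \<tau>"
  using assms by (simp add: galois_group_def BijGroup_def)

lemma restrict_in_galois_group:
  assumes E: "ring E" and f: "f \<in> ring_hom E E" "bij_betw f (carrier E) (carrier E)"
    and i: "\<And>a. a \<in> carrier k \<Longrightarrow> i a \<in> carrier E" "\<And>a. a \<in> carrier k \<Longrightarrow> f (i a) = i a"
  shows "restrict f (carrier E) \<in> carrier (galois_group k E i)"
proof -
  interpret E: ring E by fact
  have "bij_betw (restrict f (carrier E)) (carrier E) (carrier E)"
    using f(2) bij_betw_cong[of "carrier E" "restrict f (carrier E)" f "carrier E"] by simp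
  moreover have "restrict f (carrier E) \<in> ring_hom E E"
    using ring_hom_memE[OF f(1)] by (intro ring_hom_memI) auto
  ultimately show ?thesis using i by (auto simp: carrier_galois_group Bij_def)
qed

lemma group_galois_group:
  assumes E: "ring E" and i: "\<And>a. a \<in> carrier k \<Longrightarrow> i a \<in> carrier E"
  shows "group (galois_group k E i)"
proof -
  interpret E: ring E by fact
  let ?S = "carrier (galois_group k E i)"
  interpret B: group "BijGroup (carrier E)" by (rule group_BijGroup)
  have "subgroup ?S (BijGroup (carrier E))"
  proof
    show "?S \<subseteq> carrier (BijGroup (carrier E))"
      by (auto simp: carrier_galois_group BijGroup_def)
    show "\<one>\<^bsub>BijGroup (carrier E)\<^esub> \<in> ?S"
      using i by (auto simp: carrier_galois_group BijGroup_def id_Bij ring_hom_def)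
  next
    fix x y assume x: "x \<in> ?S" and y: "y \<in> ?S"
    have "x \<otimes>\<^bsub>BijGroup (carrier E)\<^esub> y = restrict (x \<circ> y) (carrier E)"
      using x y by (auto simp: carrier_galois_group BijGroup_def compose_def restrict_def)
    also have "\<dots> \<in> ?S"
      using galois_groupD[OF x] galois_groupD[OF y] i
      by (intro restrict_in_galois_group E ring_hom_trans[of y E E] bij_betw_trans[of y]) auto
    finally show "x \<otimes>\<^bsub>BijGroup (carrier E)\<^esub> y \<in> ?S" .
  next
    fix x assume x: "x \<in> ?S"
    have bij: "x \<in> Bij (carrier E)" using x by (simp add: carrier_galois_group)
    have "inv_into (carrier E) x \<in> ring_hom E E"
      using galois_groupD[OF x] ring_iso_set_sym[OF E, of x E] by (auto simp: ring_iso_def)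
    then have "restrict (inv_into (carrier E) x) (carrier E) \<in> ?S"
      using galois_groupD[OF x] i
      by (intro restrict_in_galois_group E bij_betw_inv_into) (auto simp: bij_betw_def inv_into_f_eq)
    then show "inv\<^bsub>BijGroup (carrier E)\<^esub> x \<in> ?S" using inv_BijGroup[OF bij] by simp
  qed
  then have "group (BijGroup (carrier E)\<lparr>carrier := ?S\<rparr>)"
    using subgroup.subgroup_is_group B.group_axioms by blast
  then show ?thesis by (simp add: galois_group_def)
qed

lemma inv_galois_group:
  assumes E: "ring E" and i: "\<And>a. a \<in> carrier k \<Longrightarrow> i a \<in> carrier E"
    and \<sigma>: "\<sigma> \<in> carrier (galois_group k E i)" and x: "x \<in> carrier E"
  shows "(inv\<^bsub>galois_group k E i\<^esub> \<sigma>) (\<sigma> x) = x" "\<sigma> ((inv\<^bsub>galois_group k E i\<^esub> \<sigma>) x) = x"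
proof -
  interpret G: group "galois_group k E i" using group_galois_group[of E k i] E i by blast
  have inv: "inv\<^bsub>galois_group k E i\<^esub> \<sigma> \<in> carrier (galois_group k E i)" using \<sigma> by simp
  show "(inv\<^bsub>galois_group k E i\<^esub> \<sigma>) (\<sigma> x) = x"
    using fun_cong[OF G.l_inv[OF \<sigma>], of x] mult_galois_group[OF inv \<sigma>] x
    by (simp add: compose_def one_galois_group)
  show "\<sigma> ((inv\<^bsub>galois_group k E i\<^esub> \<sigma>) x) = x"
    using fun_cong[OF G.r_inv[OF \<sigma>], of x] mult_galois_group[OF \<sigma> inv] x
    by (simp add: compose_def one_galois_group)
qed

section \<open>Finite extensions and finiteness of their Galois groups\<close>

lemma finite_field_extD:
  assumes "finite_field_ext k E i"
  shows "field k" "field E" "i \<in> ring_hom k E" "subfield (i ` carrier k) E"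
    "ring.finite_dimension E (i ` carrier k) (carrier E)" "\<And>a. a \<in> carrier k \<Longrightarrow> i a \<in> carrier E"
proof -
  show fk: "field k" and fE: "field E" and i: "i \<in> ring_hom k E" and
    "ring.finite_dimension E (i ` carrier k) (carrier E)"
    using assms by (auto simp: finite_field_ext_def)
  interpret k: field k by fact
  interpret E: field E by fact
  interpret ring_hom_ring k E i
    using ring_hom_ringI2[OF k.ring_axioms E.ring_axioms i] .
  show "subfield (i ` carrier k) E"
    using img_is_subfield(2)[OF k.carrier_is_subfield E.one_not_zero] .
  show "\<And>a. a \<in> carrier k \<Longrightarrow> i a \<in> carrier E" by simp
qed

text \<open>An automorphism is determined by its values on a spanning list, and each of these is
  a root of one of finitely many polynomials over the base field.\<close>

lemma finite_galois_group:
  assumes "finite_field_ext k E i"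
  shows "finite (carrier (galois_group k E i))"
proof -
  note E = finite_field_extD[OF assms]
  interpret E: field E by fact
  let ?F = "i ` carrier k" and ?S = "carrier (galois_group k E i)"
  obtain n where "E.dimension n ?F (carrier E)" using E(5) by (auto simp: E.finite_dimension_def)
  then obtain xs where xs: "set xs \<subseteq> carrier E" "E.Span ?F xs = carrier E"
    using E.exists_base[OF E(4)] by blast
  define R where "R = (\<Union>x \<in> set xs. {y. E.is_root (E.Irr ?F x) y})"
  have irr: "E.Irr ?F x \<in> carrier (?F[X]\<^bsub>E\<^esub>)" "E.eval (E.Irr ?F x) x = \<zero>\<^bsub>E\<^esub>" "E.Irr ?F x \<noteq> []"
    if "x \<in> set xs" for x
  proof -
    have x: "x \<in> carrier E" using that xs by blast
    have alg: "(E.algebraic over ?F) x"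
      using E.finite_dimension_imp_algebraic[OF E(4) E.carrier_is_subring E(5) x] .
    note I = E.IrrE[OF E(4) x alg]
    show "E.Irr ?F x \<in> carrier (?F[X]\<^bsub>E\<^esub>)" "E.eval (E.Irr ?F x) x = \<zero>\<^bsub>E\<^esub>" using I by auto
    show "E.Irr ?F x \<noteq> []" using E.pirreducible_degree[OF E(4) I(1,2)] by auto
  qed
  have finR: "finite R" unfolding R_def
    using E.finite_number_of_roots E.carrier_polynomial_shell[OF subfieldE(1)[OF E(4)] irr(1)]
    by (intro finite_UN_I) auto
  have root: "\<sigma> x \<in> R" if \<sigma>: "\<sigma> \<in> ?S" and x: "x \<in> set xs" for \<sigma> x
  proof -
    interpret \<sigma>: ring_hom_ring E E \<sigma>
      using ring_hom_ringI2[OF E.ring_axioms E.ring_axioms galois_groupD(1)[OF \<sigma>]] .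
    have xc: "x \<in> carrier E" using x xs by blast
    have "set (E.Irr ?F x) \<subseteq> ?F"
      using irr(1)[OF x] unfolding sym[OF univ_poly_carrier] polynomial_def by auto
    then have "map \<sigma> (E.Irr ?F x) = E.Irr ?F x"
      using galois_groupD(5)[OF \<sigma>] by (intro map_idI) auto
    then have "E.eval (E.Irr ?F x) (\<sigma> x) = \<sigma> (E.eval (E.Irr ?F x) x)"
      using \<sigma>.eval_hom[OF subfieldE(1)[OF E(4)] xc irr(1)[OF x]] by simp
    then show ?thesis unfolding R_def E.is_root_def using irr[OF x] x xc by auto
  qed
  have det: "\<sigma> = \<tau>" if \<sigma>: "\<sigma> \<in> ?S" and \<tau>: "\<tau> \<in> ?S" and eq: "map \<sigma> xs = map \<tau> xs" for \<sigma> \<tau>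
  proof -
    interpret \<sigma>: ring_hom_ring E E \<sigma>
      using ring_hom_ringI2[OF E.ring_axioms E.ring_axioms galois_groupD(1)[OF \<sigma>]] .
    interpret \<tau>: ring_hom_ring E E \<tau>
      using ring_hom_ringI2[OF E.ring_axioms E.ring_axioms galois_groupD(1)[OF \<tau>]] .
    \<comment> \<open>The equaliser of two automorphisms over k is a k-subspace, so agreement on a
      spanning list spreads to all of E.\<close>
    let ?V = "{x \<in> carrier E. \<sigma> x = \<tau> x}"
    have "subalgebra ?F ?V E"
    proof (intro subalgebra.intro subalgebra_axioms.intro)
      show "subgroup ?V (add_monoid E)"
        by (rule E.add.subgroupI) (auto simp: a_inv_def[symmetric])
      show "a \<otimes>\<^bsub>E\<^esub> v \<in> ?V" if "a \<in> ?F" "v \<in> ?V" for a v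
        using that E(6) galois_groupD(5)[OF \<sigma>] galois_groupD(5)[OF \<tau>] by auto
    qed
    moreover have "set xs \<subseteq> ?V" using xs eq by auto
    ultimately have "carrier E \<subseteq> ?V" using E.subalgebra_Span_incl[OF E(4)] xs by blast
    then show ?thesis
      using galois_groupD(2)[OF \<sigma>] galois_groupD(2)[OF \<tau>] by (intro extensionalityI) auto
  qed
  have "inj_on (\<lambda>\<sigma>. map \<sigma> xs) ?S" using det by (auto intro: inj_onI)
  moreover have "(\<lambda>\<sigma>. map \<sigma> xs) ` ?S \<subseteq> {ys. set ys \<subseteq> R \<and> length ys = length xs}"
    using root by auto
  ultimately show ?thesis
    using finite_lists_length_eq[OF finR] by (meson finite_imageD finite_subset)
qed

section \<open>Independence of characters, traces, and homomorphisms on Galois extensions\<close>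

text \<open>Artin's elimination: the relation at yx minus \<open>\<chi> s y\<close> times the
  relation at x no longer involves s. The coefficients change in this step, so the induction
  generalises over them. Distinctness is demanded on the carrier, since HOL functions may differ
  outside it.\<close>

lemma (in field) dedekind_independence:
  assumes A: "ring A" and T: "finite T"
    and hom: "\<And>t. t \<in> T \<Longrightarrow> \<chi> t \<in> ring_hom A R"
    and dist: "\<And>s t. s \<in> T \<Longrightarrow> t \<in> T \<Longrightarrow> s \<noteq> t \<Longrightarrow> \<exists>x\<in>carrier A. \<chi> s x \<noteq> \<chi> t x"
    and c: "\<And>t. t \<in> T \<Longrightarrow> c t \<in> carrier R"
    and eq: "\<And>x. x \<in> carrier A \<Longrightarrow> (\<Oplus>t\<in>T. c t \<otimes> \<chi> t x) = \<zero>"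
    and t: "t \<in> T"
  shows "c t = \<zero>"
  using T hom dist c eq t
proof (induction T arbitrary: c t rule: finite_induct)
  case empty
  then show ?case by simp
next
  case (insert s T)
  interpret A: ring A by fact
  have hom: "\<chi> t x \<in> carrier R" if "t \<in> insert s T" "x \<in> carrier A" for t x
    using insert.prems(1)[OF that(1)] that(2) by (rule ring_hom_closed)
  have cc: "c t \<in> carrier R" if "t \<in> insert s T" for t using insert.prems(3) that .
  have *: "c t = \<zero>" if t: "t \<in> T" for t
  proof -
    obtain y where y: "y \<in> carrier A" "\<chi> t y \<noteq> \<chi> s y"
      using insert.prems(2)[of t s] t insert.hyps by blast
    \<comment> \<open>These are the coefficients after eliminating s; the choice of y makes the
      factor attached to t nonzero.\<close>
    define d where "d u = c u \<otimes> (\<chi> u y \<ominus> \<chi> s y)" for u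
    have "d t = \<zero>"
    proof (rule insert.IH)
      show "\<chi> u \<in> ring_hom A R" if "u \<in> T" for u using insert.prems(1) that by blast
      show "\<exists>x\<in>carrier A. \<chi> u x \<noteq> \<chi> v x" if "u \<in> T" "v \<in> T" "u \<noteq> v" for u v
        using insert.prems(2) that by blast
      show "d u \<in> carrier R" if "u \<in> T" for u using cc hom y that by (simp add: d_def)
      show "t \<in> T" by fact
      fix x assume x: "x \<in> carrier A"
      have eq: "(\<Oplus>u\<in>T. c u \<otimes> \<chi> u x) \<oplus> c s \<otimes> \<chi> s x = \<zero>" if "x \<in> carrier A" for x
        using insert.prems(4)[OF that] insert.hyps cc hom that
        by (subst (asm) finsum_insert) (auto simp: a_comm)
      have "(\<Oplus>u\<in>T. d u \<otimes> \<chi> u x) \<oplus> (\<chi> s y \<otimes> (\<Oplus>u\<in>T. c u \<otimes> \<chi> u x)) = (\<Oplus>u\<in>T. c u \<otimes> \<chi> u (y \<otimes>\<^bsub>A\<^esub> x))"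
      proof -
        have "(\<Oplus>u\<in>T. d u \<otimes> \<chi> u x) \<oplus> (\<chi> s y \<otimes> (\<Oplus>u\<in>T. c u \<otimes> \<chi> u x))
          = (\<Oplus>u\<in>T. d u \<otimes> \<chi> u x \<oplus> \<chi> s y \<otimes> (c u \<otimes> \<chi> u x))"
          using insert.hyps cc hom x y
          by (subst finsum_rdistr) (auto simp: d_def finsum_addf)
        also have "\<dots> = (\<Oplus>u\<in>T. c u \<otimes> \<chi> u (y \<otimes>\<^bsub>A\<^esub> x))"
        proof (rule finsum_cong')
          fix u assume u: "u \<in> T"
          have "\<chi> u (y \<otimes>\<^bsub>A\<^esub> x) = \<chi> u y \<otimes> \<chi> u x"
            using insert.prems(1)[of u] u x y by (auto intro: ring_hom_mult)
          moreover have "c u \<in> carrier R" "\<chi> u y \<in> carrier R" "\<chi> u x \<in> carrier R" "\<chi> s y \<in> carrier R"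
            using cc hom u x y by auto
          ultimately show "d u \<otimes> \<chi> u x \<oplus> \<chi> s y \<otimes> (c u \<otimes> \<chi> u x) = c u \<otimes> \<chi> u (y \<otimes>\<^bsub>A\<^esub> x)"
            unfolding d_def by (simp only:) algebra
        qed (use cc hom x y in auto)
        finally show ?thesis .
      qed
      \<comment> \<open>The two relations over \<open>insert s T\<close> are solved for their sums
        over T; both sides become the negative of \<open>c s\<close> times \<open>\<chi> s y\<close>
        times \<open>\<chi> s x\<close>.\<close>
      moreover have "(\<Oplus>u\<in>T. c u \<otimes> \<chi> u (y \<otimes>\<^bsub>A\<^esub> x)) = \<chi> s y \<otimes> (\<Oplus>u\<in>T. c u \<otimes> \<chi> u x)"
      proof -
        have m: "\<chi> s (y \<otimes>\<^bsub>A\<^esub> x) = \<chi> s y \<otimes> \<chi> s x"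
          using insert.prems(1)[of s] x y by (auto intro: ring_hom_mult)
        have C: "(\<Oplus>u\<in>T. c u \<otimes> \<chi> u x) \<in> carrier R" "(\<Oplus>u\<in>T. c u \<otimes> \<chi> u (y \<otimes>\<^bsub>A\<^esub> x)) \<in> carrier R"
          "c s \<in> carrier R" "\<chi> s x \<in> carrier R" "\<chi> s y \<in> carrier R"
          using cc hom x y by (auto intro!: finsum_closed)
        have "(\<Oplus>u\<in>T. c u \<otimes> \<chi> u (y \<otimes>\<^bsub>A\<^esub> x)) = \<ominus> (c s \<otimes> (\<chi> s y \<otimes> \<chi> s x))"
          using eq[of "y \<otimes>\<^bsub>A\<^esub> x"] x y C m by (simp add: minus_equality)
        moreover have "(\<Oplus>u\<in>T. c u \<otimes> \<chi> u x) = \<ominus> (c s \<otimes> \<chi> s x)"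
          using eq[OF x] C by (simp add: minus_equality)
        ultimately show ?thesis using C by (simp only:) algebra
      qed
      moreover have "(\<Oplus>u\<in>T. d u \<otimes> \<chi> u x) \<in> carrier R" "\<chi> s y \<otimes> (\<Oplus>u\<in>T. c u \<otimes> \<chi> u x) \<in> carrier R"
        using cc hom x y by (auto simp: d_def intro!: finsum_closed m_closed)
      ultimately show "(\<Oplus>u\<in>T. d u \<otimes> \<chi> u x) = \<zero>"
        using add.r_cancel_one by simp
    qed
    moreover have "\<chi> t y \<ominus> \<chi> s y \<noteq> \<zero>" "\<chi> t y \<ominus> \<chi> s y \<in> carrier R"
      using y hom t by auto
    ultimately show ?thesis using cc t integral[of "c t" "\<chi> t y \<ominus> \<chi> s y"] by (auto simp: d_def)
  qed
  \<comment> \<open>With all other coefficients zero, the relation at 1 reduces to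
    \<open>c s\<close> because characters send 1 to 1.\<close>
  have "c s = \<zero>"
  proof -
    have "(\<Oplus>u\<in>insert s T. c u \<otimes> \<chi> u \<one>\<^bsub>A\<^esub>) = \<zero>" using insert.prems(4)[OF A.one_closed] .
    also have "(\<Oplus>u\<in>insert s T. c u \<otimes> \<chi> u \<one>\<^bsub>A\<^esub>) = c s \<otimes> \<chi> s \<one>\<^bsub>A\<^esub> \<oplus> (\<Oplus>u\<in>T. c u \<otimes> \<chi> u \<one>\<^bsub>A\<^esub>)"
      using insert.hyps cc hom by (subst finsum_insert) auto
    also have "(\<Oplus>u\<in>T. c u \<otimes> \<chi> u \<one>\<^bsub>A\<^esub>) = (\<Oplus>u\<in>T. \<zero>)"
      using * hom by (intro finsum_cong') auto
    also have "\<chi> s \<one>\<^bsub>A\<^esub> = \<one>" using insert.prems(1) by (auto intro: ring_hom_one)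
    finally show ?thesis using cc by (simp add: finsum_zero)
  qed
  then show ?case using * insert.prems(5) by auto
qed

text \<open>Applying \<open>\<tau>\<close> to the sum only permutes the summands, by left
  translation in the group. The trace is therefore fixed, and by Artin's definition fixed elements
  come from F.\<close>

lemma galois_trace_in_base:
  assumes gal: "finite_galois_ext F A \<iota>" and x: "x \<in> carrier A"
  shows "finsum A (\<lambda>\<sigma>. \<sigma> x) (carrier (galois_group F A \<iota>)) \<in> \<iota> ` carrier F"
proof -
  let ?S = "carrier (galois_group F A \<iota>)"
  have ext: "finite_field_ext F A \<iota>" using gal by (simp add: finite_galois_ext_def)
  note A = finite_field_extD[OF ext]
  interpret A: field A by fact
  interpret G: group "galois_group F A \<iota>" using group_galois_group[of A F \<iota>] A(6) A.ring_axioms by blast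
  let ?t = "finsum A (\<lambda>\<sigma>. \<sigma> x) ?S"
  have cl: "\<sigma> x \<in> carrier A" if "\<sigma> \<in> ?S" for \<sigma> using galois_groupD(4)[OF that x] .
  have "\<tau> ?t = ?t" if \<tau>: "\<tau> \<in> ?S" for \<tau>
  proof -
    interpret \<tau>: ring_hom_cring A A \<tau>
      using galois_groupD(1)[OF \<tau>] A.cring_axioms by (simp add: ring_hom_cring_def ring_hom_cring_axioms_def)
    have "\<tau> ?t = finsum A (\<lambda>\<sigma>. \<tau> (\<sigma> x)) ?S"
      using \<tau>.hom_finsum[of "\<lambda>\<sigma>. \<sigma> x" ?S] cl by (auto simp: comp_def)
    also have "\<dots> = finsum A (\<lambda>\<sigma>. (\<tau> \<otimes>\<^bsub>galois_group F A \<iota>\<^esub> \<sigma>) x) ?S"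
      using mult_galois_group[OF \<tau>] x cl
      by (intro A.finsum_cong') (auto simp: compose_def)
    also have "\<dots> = finsum A (\<lambda>\<sigma>. \<sigma> x) ((\<lambda>\<sigma>. \<tau> \<otimes>\<^bsub>galois_group F A \<iota>\<^esub> \<sigma>) ` ?S)"
      using \<tau> cl by (subst A.finsum_reindex) (auto simp: inj_on_def)
    also have "(\<lambda>\<sigma>. \<tau> \<otimes>\<^bsub>galois_group F A \<iota>\<^esub> \<sigma>) ` ?S = ?S"
      using G.surj_const_mult[OF \<tau>] .
    finally show ?thesis .
  qed
  moreover have "?t \<in> carrier A" using cl by (intro A.finsum_closed) auto
  ultimately show ?thesis using gal by (auto simp: finite_galois_ext_def)
qed

text \<open>Both families \<open>h \<circ> \<sigma>\<close> and \<open>h' \<circ> \<sigma>\<close> have the same sum, since the trace lies in the base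
  field; by independence they cannot be disjoint.\<close>

lemma hom_eq_hom_comp_galois:
  assumes gal: "finite_galois_ext F A \<iota>" and \<Omega>: "field \<Omega>"
    and h: "h \<in> ring_hom A \<Omega>" and h': "h' \<in> ring_hom A \<Omega>"
    and agree: "\<And>a. a \<in> carrier F \<Longrightarrow> h (\<iota> a) = h' (\<iota> a)"
  obtains \<tau> where "\<tau> \<in> carrier (galois_group F A \<iota>)" "\<And>x. x \<in> carrier A \<Longrightarrow> h x = h' (\<tau> x)"
proof -
  let ?G = "galois_group F A \<iota>"
  let ?S = "carrier ?G"
  have ext: "finite_field_ext F A \<iota>" using gal by (simp add: finite_galois_ext_def)
  note A = finite_field_extD[OF ext]
  interpret A: field A by fact
  interpret \<Omega>: field \<Omega> by fact
  interpret G: group ?G using group_galois_group[of A F \<iota>] A(6) A.ring_axioms by blast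
  interpret h: ring_hom_cring A \<Omega> h
    using h A.cring_axioms \<Omega>.cring_axioms by (simp add: ring_hom_cring_def ring_hom_cring_axioms_def)
  interpret h': ring_hom_cring A \<Omega> h'
    using h' A.cring_axioms \<Omega>.cring_axioms by (simp add: ring_hom_cring_def ring_hom_cring_axioms_def)
  have inj: "inj_on h (carrier A)" "inj_on h' (carrier A)"
    using non_trivial_field_hom_is_inj h h' A.field_axioms \<Omega>.field_axioms by blast+
  have fin: "finite ?S" using finite_galois_group[OF ext] .
  have cl: "\<sigma> x \<in> carrier A" if "\<sigma> \<in> ?S" "x \<in> carrier A" for \<sigma> x using galois_groupD(4)[OF that] .
  have one: "\<one>\<^bsub>?G\<^esub> \<in> ?S" by (rule G.one_closed)
  have "\<exists>\<tau>\<in>?S. \<forall>x\<in>carrier A. h x = h' (\<tau> x)"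
  proof (rule ccontr)
    assume none: "\<not> (\<exists>\<tau>\<in>?S. \<forall>x\<in>carrier A. h x = h' (\<tau> x))"
    \<comment> \<open>The Boolean separates the family of all \<open>h \<circ> \<sigma>\<close> from
      that of all \<open>h' \<circ> \<sigma>\<close>; the signs in \<open>c\<close> turn the
      equality of the two sums into one linear relation.\<close>
    define \<chi> where "\<chi> p x = (if fst p then h (snd p x) else h' (snd p x))" for p :: "bool \<times> ('c \<Rightarrow> 'c)" and x
    define c where "c p = (if fst p then \<one>\<^bsub>\<Omega>\<^esub> else \<ominus>\<^bsub>\<Omega>\<^esub> \<one>\<^bsub>\<Omega>\<^esub>)" for p :: "bool \<times> ('c \<Rightarrow> 'c)"
    define T where "T = Pair True ` ?S \<union> Pair False ` ?S"
    \<comment> \<open>A coincidence of \<open>h \<circ> \<sigma>\<close> with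
      \<open>h' \<circ> \<tau>\<close> would give h as h' composed with
      \<open>\<tau> \<sigma>\<close>^-1, in an order that \<open>none\<close> excludes.\<close>
    have mixed: "\<exists>x\<in>carrier A. h (\<sigma> x) \<noteq> h' (\<tau> x)" if \<sigma>: "\<sigma> \<in> ?S" and \<tau>: "\<tau> \<in> ?S" for \<sigma> \<tau>
    proof (rule ccontr)
      assume *: "\<not> (\<exists>x\<in>carrier A. h (\<sigma> x) \<noteq> h' (\<tau> x))"
      define \<rho> where "\<rho> = inv\<^bsub>?G\<^esub> \<sigma>"
      have \<rho>: "\<rho> \<in> ?S" using \<sigma> by (simp add: \<rho>_def)
      have "h x = h' ((\<tau> \<otimes>\<^bsub>?G\<^esub> \<rho>) x)" if x: "x \<in> carrier A" for x
      proof -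
        have "h x = h (\<sigma> (\<rho> x))"
          using inv_galois_group(2)[OF A.ring_axioms A(6) \<sigma> x] by (simp add: \<rho>_def)
        also have "\<dots> = h' (\<tau> (\<rho> x))" using * cl[OF \<rho> x] by blast
        finally show ?thesis using mult_galois_group[OF \<tau> \<rho>] x by (simp add: compose_def)
      qed
      moreover have "\<tau> \<otimes>\<^bsub>?G\<^esub> \<rho> \<in> ?S" using \<tau> \<rho> by simp
      ultimately show False using none by blast
    qed
    have same: "\<exists>x\<in>carrier A. \<sigma> x \<noteq> \<tau> x" if "\<sigma> \<in> ?S" "\<tau> \<in> ?S" "\<sigma> \<noteq> \<tau>" for \<sigma> \<tau>
      using extensionalityI[OF galois_groupD(2)[OF that(1)] galois_groupD(2)[OF that(2)]] that(3) by blast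
    \<comment> \<open>This is the coefficient of h itself. It equals 1, so its vanishing is the
      contradiction.\<close>
    have "c (True, \<one>\<^bsub>?G\<^esub>) = \<zero>\<^bsub>\<Omega>\<^esub>"
    proof (rule \<Omega>.dedekind_independence[OF A.ring_axioms, of T \<chi> c])
      show "finite T" using fin by (simp add: T_def)
      show "\<chi> t \<in> ring_hom A \<Omega>" if t: "t \<in> T" for t
      proof -
        obtain \<sigma> where \<sigma>: "\<sigma> \<in> ?S" "t = (True, \<sigma>) \<or> t = (False, \<sigma>)" using t by (auto simp: T_def)
        have "h \<circ> \<sigma> \<in> ring_hom A \<Omega>" "h' \<circ> \<sigma> \<in> ring_hom A \<Omega>"
          using ring_hom_trans[OF galois_groupD(1)[OF \<sigma>(1)]] h h' by auto
        moreover have "\<chi> t = h \<circ> \<sigma> \<or> \<chi> t = h' \<circ> \<sigma>" using \<sigma>(2) by (auto simp: \<chi>_def fun_eq_iff)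
        ultimately show ?thesis by auto
      qed
      show "\<exists>x\<in>carrier A. \<chi> s x \<noteq> \<chi> t x" if "s \<in> T" "t \<in> T" "s \<noteq> t" for s t
      proof -
        obtain b \<sigma> where s: "s = (b, \<sigma>)" by (cases s)
        obtain b' \<tau> where t: "t = (b', \<tau>)" by (cases t)
        have \<sigma>: "\<sigma> \<in> ?S" and \<tau>: "\<tau> \<in> ?S" using that s t by (auto simp: T_def)
        show ?thesis
        proof (cases "b = b'")
          case True
          then have "\<sigma> \<noteq> \<tau>" using that s t by simp
          then obtain x where x: "x \<in> carrier A" "\<sigma> x \<noteq> \<tau> x" using same[OF \<sigma> \<tau>] by blast
          then have "h (\<sigma> x) \<noteq> h (\<tau> x)" "h' (\<sigma> x) \<noteq> h' (\<tau> x)"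
            using inj cl[OF \<sigma> x(1)] cl[OF \<tau> x(1)] by (auto simp: inj_on_def)
          then show ?thesis using x s t True by (auto simp: \<chi>_def)
        next
          case False
          moreover obtain x y where "x \<in> carrier A" "h (\<sigma> x) \<noteq> h' (\<tau> x)" "y \<in> carrier A" "h (\<tau> y) \<noteq> h' (\<sigma> y)"
            using mixed[OF \<sigma> \<tau>] mixed[OF \<tau> \<sigma>] by blast
          moreover from this have "h' (\<sigma> y) \<noteq> h (\<tau> y)" by simp
          ultimately show ?thesis unfolding s t \<chi>_def by (cases b; cases b') auto
        qed
      qed
      show "c t \<in> carrier \<Omega>" for t by (simp add: c_def)
      show "(True, \<one>\<^bsub>?G\<^esub>) \<in> T" using one by (simp add: T_def)
      fix x assume x: "x \<in> carrier A"
      have clh: "h (\<sigma> x) \<in> carrier \<Omega>" "h' (\<sigma> x) \<in> carrier \<Omega>" if "\<sigma> \<in> ?S" for \<sigma>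
        using cl[OF that x] by auto
      define tr where "tr = finsum A (\<lambda>\<sigma>. \<sigma> x) ?S"
      have tr: "tr \<in> \<iota> ` carrier F" "tr \<in> carrier A"
        using galois_trace_in_base[OF gal x] A(6) by (auto simp: tr_def)
      have sums: "finsum \<Omega> (\<lambda>\<sigma>. h (\<sigma> x)) ?S = h tr" "finsum \<Omega> (\<lambda>\<sigma>. h' (\<sigma> x)) ?S = h' tr"
        using h.hom_finsum[of "\<lambda>\<sigma>. \<sigma> x" ?S] h'.hom_finsum[of "\<lambda>\<sigma>. \<sigma> x" ?S] cl[OF _ x]
        by (auto simp: tr_def comp_def)
      have eq1: "finsum \<Omega> (\<lambda>p. c p \<otimes>\<^bsub>\<Omega>\<^esub> \<chi> p x) (Pair True ` ?S) = h tr"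
      proof -
        have "finsum \<Omega> (\<lambda>p. c p \<otimes>\<^bsub>\<Omega>\<^esub> \<chi> p x) (Pair True ` ?S) = finsum \<Omega> (\<lambda>\<sigma>. c (True, \<sigma>) \<otimes>\<^bsub>\<Omega>\<^esub> \<chi> (True, \<sigma>) x) ?S"
          using clh by (subst \<Omega>.finsum_reindex) (auto simp: inj_on_def c_def \<chi>_def)
        also have "\<dots> = finsum \<Omega> (\<lambda>\<sigma>. h (\<sigma> x)) ?S"
          using clh by (intro \<Omega>.finsum_cong') (auto simp: c_def \<chi>_def)
        finally show ?thesis using sums by simp
      qed
      have eq2: "finsum \<Omega> (\<lambda>p. c p \<otimes>\<^bsub>\<Omega>\<^esub> \<chi> p x) (Pair False ` ?S) = \<ominus>\<^bsub>\<Omega>\<^esub> h' tr"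
      proof -
        have "finsum \<Omega> (\<lambda>p. c p \<otimes>\<^bsub>\<Omega>\<^esub> \<chi> p x) (Pair False ` ?S) = finsum \<Omega> (\<lambda>\<sigma>. c (False, \<sigma>) \<otimes>\<^bsub>\<Omega>\<^esub> \<chi> (False, \<sigma>) x) ?S"
          using clh by (subst \<Omega>.finsum_reindex) (auto simp: inj_on_def c_def \<chi>_def)
        also have "\<dots> = finsum \<Omega> (\<lambda>\<sigma>. \<ominus>\<^bsub>\<Omega>\<^esub> \<one>\<^bsub>\<Omega>\<^esub> \<otimes>\<^bsub>\<Omega>\<^esub> h' (\<sigma> x)) ?S"
          using clh by (intro \<Omega>.finsum_cong') (auto simp: c_def \<chi>_def)
        also have "\<dots> = \<ominus>\<^bsub>\<Omega>\<^esub> \<one>\<^bsub>\<Omega>\<^esub> \<otimes>\<^bsub>\<Omega>\<^esub> finsum \<Omega> (\<lambda>\<sigma>. h' (\<sigma> x)) ?S"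
          using clh fin by (subst \<Omega>.finsum_rdistr) auto
        finally show ?thesis using sums tr by (simp add: \<Omega>.l_minus)
      qed
      have "finsum \<Omega> (\<lambda>p. c p \<otimes>\<^bsub>\<Omega>\<^esub> \<chi> p x) T = h tr \<oplus>\<^bsub>\<Omega>\<^esub> \<ominus>\<^bsub>\<Omega>\<^esub> h' tr"
        unfolding T_def eq1[symmetric] eq2[symmetric] using fin clh
        by (intro \<Omega>.finsum_Un_disjoint) (auto simp: c_def \<chi>_def)
      also have "h tr = h' tr" using tr(1) agree by auto
      finally show "finsum \<Omega> (\<lambda>p. c p \<otimes>\<^bsub>\<Omega>\<^esub> \<chi> p x) T = \<zero>\<^bsub>\<Omega>\<^esub>" using tr by (simp add: \<Omega>.r_neg)
    qed
    then show False by (simp add: c_def)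
  qed
  then show ?thesis using that by blast
qed

section \<open>Tensor products\<close>

lemma (in ideal) quotient_hom_lift:
  assumes S: "ring S" and f: "f \<in> ring_hom R S" and ker: "\<And>x. x \<in> I \<Longrightarrow> f x = \<zero>\<^bsub>S\<^esub>"
  obtains u where "u \<in> ring_hom (R Quot I) S" "\<And>x. x \<in> carrier R \<Longrightarrow> u (I +> x) = f x"
proof -
  interpret f: ring_hom_ring R S f using ring_hom_ringI2[OF ring_axioms S f] .
  have car: "carrier (R Quot I) = (\<lambda>x. I +> x) ` carrier R"
    by (auto simp: FactRing_def A_RCOSETS_def')
  have wd: "f x = f y" if "x \<in> carrier R" "y \<in> carrier R" "I +> x = I +> y" for x y
  proof -
    have "x \<ominus> y \<in> I" using quotient_eq_iff_same_a_r_cos[OF ideal_axioms that(1,2)] that(3) by simp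
    then have "f x \<ominus>\<^bsub>S\<^esub> f y = \<zero>\<^bsub>S\<^esub>" using ker[of "x \<ominus> y"] that by (simp add: a_minus_def)
    then show ?thesis using that by (simp add: f.S.r_right_minus_eq)
  qed
  define u where "u C = f (SOME x. x \<in> carrier R \<and> C = I +> x)" for C
  have u: "u (I +> x) = f x" if x: "x \<in> carrier R" for x
  proof -
    have "(SOME y. y \<in> carrier R \<and> I +> x = I +> y) \<in> carrier R \<and>
      I +> x = I +> (SOME y. y \<in> carrier R \<and> I +> x = I +> y)"
      by (rule someI[of _ x]) (use x in simp)
    then show ?thesis unfolding u_def using wd x by metis
  qed
  note rcos = ring_hom_memE[OF rcos_ring_hom]
  have "u \<in> ring_hom (R Quot I) S"
  proof (rule ring_hom_memI)
    fix C D assume "C \<in> carrier (R Quot I)" "D \<in> carrier (R Quot I)"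
    then obtain x y where xy: "x \<in> carrier R" "y \<in> carrier R" "C = I +> x" "D = I +> y"
      unfolding car by blast
    show "u C \<in> carrier S" using xy u by simp
    show "u (C \<otimes>\<^bsub>R Quot I\<^esub> D) = u C \<otimes>\<^bsub>S\<^esub> u D"
      using rcos(2)[OF xy(1,2)] xy u by (metis f.hom_mult m_closed)
    show "u (C \<oplus>\<^bsub>R Quot I\<^esub> D) = u C \<oplus>\<^bsub>S\<^esub> u D"
      using rcos(3)[OF xy(1,2)] xy u by (metis f.hom_add a_closed)
  next
    show "u \<one>\<^bsub>R Quot I\<^esub> = \<one>\<^bsub>S\<^esub>" using rcos(4) u by (metis f.hom_one one_closed)
  qed
  then show ?thesis using that u by blast
qed

lemma monoid_ring_simps [simp]:
  "c \<in> carrier (monoid_ring M) \<longleftrightarrow> Poly_Mapping.keys c \<subseteq> carrier M"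
  "\<zero>\<^bsub>monoid_ring M\<^esub> = 0"
  "\<one>\<^bsub>monoid_ring M\<^esub> = frag_of \<one>\<^bsub>M\<^esub>"
  "x \<oplus>\<^bsub>monoid_ring M\<^esub> y = x + y"
  "frag_of a \<otimes>\<^bsub>monoid_ring M\<^esub> frag_of b = frag_of (a \<otimes>\<^bsub>M\<^esub> b)"
  by (simp_all add: monoid_ring_def)

lemma monoid_ring_mult_diff:
  "(x - y) \<otimes>\<^bsub>monoid_ring M\<^esub> z = x \<otimes>\<^bsub>monoid_ring M\<^esub> z - y \<otimes>\<^bsub>monoid_ring M\<^esub> z"
  "frag_of a \<otimes>\<^bsub>monoid_ring M\<^esub> (x - y) = frag_of a \<otimes>\<^bsub>monoid_ring M\<^esub> x - frag_of a \<otimes>\<^bsub>monoid_ring M\<^esub> y"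
  by (simp_all add: monoid_ring_def frag_extend_diff)

text \<open>Functoriality of the monoid ring: both sides are biadditive, so multiplicativity is
  checked on basis elements. It is applied to \<open>id\<close> times \<open>\<sigma>\<close> on the
  pairs that generate the tensor product.\<close>

lemma monoid_ring_hom_map:
  assumes M: "comm_monoid M" and f: "f \<in> hom M M" "f \<one>\<^bsub>M\<^esub> = \<one>\<^bsub>M\<^esub>"
  shows "frag_extend (frag_of \<circ> f) \<in> ring_hom (monoid_ring M) (monoid_ring M)"
proof -
  interpret M: comm_monoid M by fact
  let ?\<Phi> = "frag_extend (frag_of \<circ> f)"
  have f1: "f x \<in> carrier M" if "x \<in> carrier M" for x using f(1) that by (auto simp: hom_def)
  have f2: "f (x \<otimes>\<^bsub>M\<^esub> y) = f x \<otimes>\<^bsub>M\<^esub> f y" if "x \<in> carrier M" "y \<in> carrier M" for x y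
    using f(1) that by (auto simp: hom_def)
  show ?thesis
  proof (rule ring_hom_memI)
    fix c d assume "c \<in> carrier (monoid_ring M)" "d \<in> carrier (monoid_ring M)"
    then have c: "Poly_Mapping.keys c \<subseteq> carrier M" and d: "Poly_Mapping.keys d \<subseteq> carrier M" by auto
    have "Poly_Mapping.keys (?\<Phi> c) \<subseteq> carrier M"
      by (rule order_trans[OF keys_frag_extend]) (use c f1 in \<open>auto simp: subset_iff\<close>)
    then show "?\<Phi> c \<in> carrier (monoid_ring M)" by simp
    show "?\<Phi> (c \<oplus>\<^bsub>monoid_ring M\<^esub> d) = ?\<Phi> c \<oplus>\<^bsub>monoid_ring M\<^esub> ?\<Phi> d" by (simp add: frag_extend_add)
    show "?\<Phi> (c \<otimes>\<^bsub>monoid_ring M\<^esub> d) = ?\<Phi> c \<otimes>\<^bsub>monoid_ring M\<^esub> ?\<Phi> d"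
      using c
    proof (induction c rule: frag_induction)
      case zero
      then show ?case by (simp add: monoid_ring_def)
    next
      case (one a)
      show ?case using d
      proof (induction d rule: frag_induction)
        case zero
        then show ?case by (simp add: monoid_ring_def)
      next
        case (one b)
        then show ?case using f2 \<open>a \<in> carrier M\<close> by simp
      next
        case (diff x y)
        then show ?case by (simp add: monoid_ring_mult_diff frag_extend_diff)
      qed
    next
      case (diff x y)
      then show ?case by (simp add: monoid_ring_mult_diff frag_extend_diff)
    qed
  qed (use f in simp)
qed

section \<open>The tensor product of commutative algebras and its homomorphisms\<close>

locale tensor_of_algebras =
  k: cring k + E: cring E + L: cring L
  for k :: "('k, 'p) ring_scheme" and E :: "('e, 'q) ring_scheme" and L :: "('l, 'r) ring_scheme" +
  fixes i :: "'k \<Rightarrow> 'e" and j :: "'k \<Rightarrow> 'l"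
  assumes i: "i \<in> ring_hom k E" and j: "j \<in> ring_hom k L"
begin

abbreviation "T \<equiv> tensor_ring k E i L j"
abbreviation "pure \<equiv> pure_tensor k E i L j"

lemma comm_monoid_prod: "comm_monoid (E \<times>\<times> L)"
proof -
  have "monoid (E \<times>\<times> L)" using DirProd_monoid[OF E.monoid_axioms L.monoid_axioms] .
  then show ?thesis
    by (rule monoid.monoid_comm_monoidI) (auto simp: E.m_comm L.m_comm)
qed

sublocale M: cring "monoid_ring (E \<times>\<times> L)"
  using monoid_ring_is_cring[OF comm_monoid_prod] .

lemma relations_in_carrier: "bilinear_relations k E i L j \<subseteq> carrier (monoid_ring (E \<times>\<times> L))"
proof -
  have *: "x - y \<in> carrier (monoid_ring (E \<times>\<times> L))"
    if "x \<in> carrier (monoid_ring (E \<times>\<times> L))" "y \<in> carrier (monoid_ring (E \<times>\<times> L))" for x y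
    using that keys_diff[of x y] by auto
  show ?thesis
    unfolding bilinear_relations_def
    using ring_hom_closed[OF i] ring_hom_closed[OF j] by (auto intro!: * simp del: monoid_ring_simps(1)) (auto)
qed

sublocale I: ideal "tensor_ideal k E i L j" "monoid_ring (E \<times>\<times> L)"
  unfolding tensor_ideal_def using M.genideal_ideal[OF relations_in_carrier] .

lemma ring_tensor: "ring T" unfolding tensor_ring_def by (rule I.quotient_is_ring)

lemma pure_mult:
  assumes "e \<in> carrier E" "e' \<in> carrier E" "l \<in> carrier L" "l' \<in> carrier L"
  shows "pure e l \<otimes>\<^bsub>T\<^esub> pure e' l' = pure (e \<otimes>\<^bsub>E\<^esub> e') (l \<otimes>\<^bsub>L\<^esub> l')"
  using ring_hom_mult[OF I.rcos_ring_hom, of "frag_of (e, l)" "frag_of (e', l')"] assms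
  by (simp add: pure_tensor_def tensor_ring_def)

lemma pure_closed:
  assumes "e \<in> carrier E" "l \<in> carrier L"
  shows "pure e l \<in> carrier T"
  using ring_hom_closed[OF I.rcos_ring_hom, of "frag_of (e, l)"] assms
  by (simp add: pure_tensor_def tensor_ring_def)

text \<open>The bilinearity relations use the subtraction of formal sums, whereas equality of cosets
  is governed by the subtraction \<open>\<ominus>\<close> of the ring. The two agree on the carrier,
  which lets a relation be read as an equation in the quotient.\<close>

lemma rcos_relation:
  assumes "x - y \<in> tensor_ideal k E i L j" "x \<in> carrier (monoid_ring (E \<times>\<times> L))" "y \<in> carrier (monoid_ring (E \<times>\<times> L))"
  shows "tensor_ideal k E i L j +>\<^bsub>monoid_ring (E \<times>\<times> L)\<^esub> x = tensor_ideal k E i L j +>\<^bsub>monoid_ring (E \<times>\<times> L)\<^esub> y"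
proof -
  have "(x - y) \<oplus>\<^bsub>monoid_ring (E \<times>\<times> L)\<^esub> y = x" by simp
  moreover have "x - y \<in> carrier (monoid_ring (E \<times>\<times> L))" using assms(1) I.a_Hcarr by blast
  ultimately have "x \<ominus>\<^bsub>monoid_ring (E \<times>\<times> L)\<^esub> y = x - y"
    using assms(2,3) by (metis M.add.inv_solve_right M.minus_eq)
  then show ?thesis using M.quotient_eq_iff_same_a_r_cos[OF I.ideal_axioms assms(2,3)] assms(1) by simp
qed

lemma pure_hom_left: "(\<lambda>e. pure e \<one>\<^bsub>L\<^esub>) \<in> ring_hom E T"
proof (rule ring_hom_memI)
  fix e e' assume e: "e \<in> carrier E" "e' \<in> carrier E"
  show "pure e \<one>\<^bsub>L\<^esub> \<in> carrier T" using pure_closed e by simp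
  show "pure (e \<otimes>\<^bsub>E\<^esub> e') \<one>\<^bsub>L\<^esub> = pure e \<one>\<^bsub>L\<^esub> \<otimes>\<^bsub>T\<^esub> pure e' \<one>\<^bsub>L\<^esub>" using pure_mult[of e e' "\<one>\<^bsub>L\<^esub>" "\<one>\<^bsub>L\<^esub>"] e by simp
  let ?a = "frag_of (e \<oplus>\<^bsub>E\<^esub> e', \<one>\<^bsub>L\<^esub>)" and ?b = "frag_of (e, \<one>\<^bsub>L\<^esub>) + frag_of (e', \<one>\<^bsub>L\<^esub>)"
  have "?a - frag_of (e, \<one>\<^bsub>L\<^esub>) - frag_of (e', \<one>\<^bsub>L\<^esub>) \<in> bilinear_relations k E i L j"
    using e L.one_closed unfolding bilinear_relations_def by blast
  then have "?a - ?b \<in> tensor_ideal k E i L j"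
    using M.genideal_self[OF relations_in_carrier] unfolding tensor_ideal_def by (auto simp: diff_diff_eq)
  moreover have "?b \<in> carrier (monoid_ring (E \<times>\<times> L))"
    using M.a_closed[of "frag_of (e, \<one>\<^bsub>L\<^esub>)" "frag_of (e', \<one>\<^bsub>L\<^esub>)"] e by simp
  ultimately show "pure (e \<oplus>\<^bsub>E\<^esub> e') \<one>\<^bsub>L\<^esub> = pure e \<one>\<^bsub>L\<^esub> \<oplus>\<^bsub>T\<^esub> pure e' \<one>\<^bsub>L\<^esub>"
    using rcos_relation[of ?a ?b] e ring_hom_add[OF I.rcos_ring_hom, of "frag_of (e, \<one>\<^bsub>L\<^esub>)" "frag_of (e', \<one>\<^bsub>L\<^esub>)"]
    by (simp add: pure_tensor_def tensor_ring_def)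
next
  show "pure \<one>\<^bsub>E\<^esub> \<one>\<^bsub>L\<^esub> = \<one>\<^bsub>T\<^esub>"
    using ring_hom_one[OF I.rcos_ring_hom] by (simp add: pure_tensor_def tensor_ring_def)
qed

lemma pure_balanced:
  assumes "a \<in> carrier k"
  shows "pure (i a) \<one>\<^bsub>L\<^esub> = pure \<one>\<^bsub>E\<^esub> (j a)"
proof -
  note ij = ring_hom_closed[OF i assms] ring_hom_closed[OF j assms]
  have "frag_of (i a \<otimes>\<^bsub>E\<^esub> \<one>\<^bsub>E\<^esub>, \<one>\<^bsub>L\<^esub>) - frag_of (\<one>\<^bsub>E\<^esub>, j a \<otimes>\<^bsub>L\<^esub> \<one>\<^bsub>L\<^esub>) \<in> bilinear_relations k E i L j"
    using assms E.one_closed L.one_closed unfolding bilinear_relations_def by blast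
  then have "frag_of (i a, \<one>\<^bsub>L\<^esub>) - frag_of (\<one>\<^bsub>E\<^esub>, j a) \<in> tensor_ideal k E i L j"
    using M.genideal_self[OF relations_in_carrier] ij unfolding tensor_ideal_def by auto
  then show ?thesis using rcos_relation ij by (simp add: pure_tensor_def)
qed

text \<open>A pure tensor is the product of an element of E and an element of L, and pure tensors
  generate the tensor product additively, so a homomorphism is determined on the two
  factors.\<close>

lemma hom_eqI:
  assumes R: "ring R" and f: "f \<in> ring_hom T R" and g: "g \<in> ring_hom T R"
    and E: "\<And>e. e \<in> carrier E \<Longrightarrow> f (pure e \<one>\<^bsub>L\<^esub>) = g (pure e \<one>\<^bsub>L\<^esub>)"
    and L: "\<And>l. l \<in> carrier L \<Longrightarrow> f (pure \<one>\<^bsub>E\<^esub> l) = g (pure \<one>\<^bsub>E\<^esub> l)"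
    and x: "x \<in> carrier T"
  shows "f x = g x"
proof -
  interpret R: ring R by fact
  let ?M = "monoid_ring (E \<times>\<times> L)"
  define p where "p c = tensor_ideal k E i L j +>\<^bsub>?M\<^esub> c" for c
  have p: "p \<in> ring_hom ?M T" unfolding p_def tensor_ring_def by (rule I.rcos_ring_hom)
  interpret f: ring_hom_ring ?M R "f \<circ> p"
    using ring_hom_ringI2[OF M.ring_axioms R ring_hom_trans[OF p f]] .
  interpret g: ring_hom_ring ?M R "g \<circ> p"
    using ring_hom_ringI2[OF M.ring_axioms R ring_hom_trans[OF p g]] .
  have gen: "c \<in> carrier ?M \<and> f (p c) = g (p c)" if c: "Poly_Mapping.keys c \<subseteq> carrier (E \<times>\<times> L)" for c
    using c
  proof (induction c rule: frag_induction)
    case zero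
    then show ?case using f.hom_zero g.hom_zero by simp
  next
    case (one a)
    then obtain e l where a: "a = (e, l)" "e \<in> carrier E" "l \<in> carrier L" by auto
    have "p (frag_of a) = pure e \<one>\<^bsub>L\<^esub> \<otimes>\<^bsub>T\<^esub> pure \<one>\<^bsub>E\<^esub> l"
      using pure_mult[of e "\<one>\<^bsub>E\<^esub>" "\<one>\<^bsub>L\<^esub>" l] a by (simp add: p_def pure_tensor_def)
    then show ?case
      using a E L ring_hom_mult[OF f] ring_hom_mult[OF g] pure_closed by simp
  next
    case (diff a b)
    \<comment> \<open>The induction is over differences. Writing a as (a - b) + b allows additivity
      of the homomorphisms and cancellation to settle this case.\<close>
    have ab: "a - b \<in> carrier ?M" using diff keys_diff[of a b] by auto
    have "f (p ((a - b) \<oplus>\<^bsub>?M\<^esub> b)) = f (p (a - b)) \<oplus>\<^bsub>R\<^esub> f (p b)"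
      "g (p ((a - b) \<oplus>\<^bsub>?M\<^esub> b)) = g (p (a - b)) \<oplus>\<^bsub>R\<^esub> g (p b)"
      using f.hom_add[OF ab, of b] g.hom_add[OF ab, of b] diff by (auto simp: comp_def)
    then have "f (p (a - b)) \<oplus>\<^bsub>R\<^esub> f (p b) = g (p (a - b)) \<oplus>\<^bsub>R\<^esub> f (p b)" using diff by simp
    then have "f (p (a - b)) = g (p (a - b))"
      using f.hom_closed[OF ab] g.hom_closed[OF ab] f.hom_closed[of b] diff by (simp add: comp_def)
    then show ?case using ab by simp
  qed
  obtain c where "c \<in> carrier ?M" "x = p c"
    using x by (auto simp: tensor_ring_def FactRing_def A_RCOSETS_def' p_def)
  then show ?thesis using gen by simp
qed

text \<open>This is \<open>1 \<otimes> \<sigma>\<close>. Applying \<open>\<sigma>\<close> to second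
  components sends every bilinearity relation to one of the same kind, the relation over k because
  \<open>\<sigma>\<close> fixes the image of k, so the map descends to the quotient.\<close>

lemma right_factor_endomorphism:
  assumes \<sigma>: "\<sigma> \<in> ring_hom L L" and fixes_base: "\<And>a. a \<in> carrier k \<Longrightarrow> \<sigma> (j a) = j a"
  obtains u where "u \<in> ring_hom T T"
    "\<And>e l. e \<in> carrier E \<Longrightarrow> l \<in> carrier L \<Longrightarrow> u (pure e l) = pure e (\<sigma> l)"
proof -
  let ?M = "monoid_ring (E \<times>\<times> L)" and ?I = "tensor_ideal k E i L j"
  note \<sigma>' = ring_hom_memE[OF \<sigma>]
  define f :: "'e \<times> 'l \<Rightarrow> 'e \<times> 'l" where "f = map_prod id \<sigma>"
  define \<Phi> where "\<Phi> = frag_extend (frag_of \<circ> f)"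
  define p where "p c = ?I +>\<^bsub>?M\<^esub> c" for c
  have p: "p \<in> ring_hom ?M T" unfolding p_def tensor_ring_def by (rule I.rcos_ring_hom)
  have "f \<in> hom (E \<times>\<times> L) (E \<times>\<times> L)" "f \<one>\<^bsub>E \<times>\<times> L\<^esub> = \<one>\<^bsub>E \<times>\<times> L\<^esub>"
    using \<sigma>' by (auto simp: f_def hom_def)
  then have \<Phi>: "\<Phi> \<in> ring_hom ?M ?M" unfolding \<Phi>_def by (rule monoid_ring_hom_map[OF comm_monoid_prod])
  interpret \<Psi>: ring_hom_ring ?M T "p \<circ> \<Phi>"
    using ring_hom_ringI2[OF M.ring_axioms ring_tensor ring_hom_trans[OF \<Phi> p]] .
  have rel: "\<Phi> r \<in> bilinear_relations k E i L j" if r: "r \<in> bilinear_relations k E i L j" for r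
  proof -
    consider (1) e e' l where "r = frag_of (e \<oplus>\<^bsub>E\<^esub> e', l) - frag_of (e, l) - frag_of (e', l)"
        "e \<in> carrier E" "e' \<in> carrier E" "l \<in> carrier L"
      | (2) e l l' where "r = frag_of (e, l \<oplus>\<^bsub>L\<^esub> l') - frag_of (e, l) - frag_of (e, l')"
        "e \<in> carrier E" "l \<in> carrier L" "l' \<in> carrier L"
      | (3) a e l where "r = frag_of (i a \<otimes>\<^bsub>E\<^esub> e, l) - frag_of (e, j a \<otimes>\<^bsub>L\<^esub> l)"
        "a \<in> carrier k" "e \<in> carrier E" "l \<in> carrier L"
      using r unfolding bilinear_relations_def by blast
    then show ?thesis
    proof cases
      case 1
      then have "\<Phi> r = frag_of (e \<oplus>\<^bsub>E\<^esub> e', \<sigma> l) - frag_of (e, \<sigma> l) - frag_of (e', \<sigma> l)"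
        by (simp add: \<Phi>_def f_def frag_extend_diff)
      then show ?thesis using 1 \<sigma>'(1)[OF 1(4)] unfolding bilinear_relations_def by blast
    next
      case 2
      then have "\<Phi> r = frag_of (e, \<sigma> l \<oplus>\<^bsub>L\<^esub> \<sigma> l') - frag_of (e, \<sigma> l) - frag_of (e, \<sigma> l')"
        by (simp add: \<Phi>_def f_def frag_extend_diff \<sigma>')
      then show ?thesis using 2 \<sigma>'(1)[OF 2(3)] \<sigma>'(1)[OF 2(4)] unfolding bilinear_relations_def by blast
    next
      case 3
      then have "\<Phi> r = frag_of (i a \<otimes>\<^bsub>E\<^esub> e, \<sigma> l) - frag_of (e, j a \<otimes>\<^bsub>L\<^esub> \<sigma> l)"
        using ring_hom_closed[OF j] by (simp add: \<Phi>_def f_def frag_extend_diff \<sigma>' fixes_base)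
      then show ?thesis using 3 \<sigma>'(1)[OF 3(4)] unfolding bilinear_relations_def by blast
    qed
  qed
  \<comment> \<open>The kernel is an ideal, so it is enough that it contains the generators of the
    tensor ideal.\<close>
  have "?I \<subseteq> a_kernel ?M T (p \<circ> \<Phi>)"
    unfolding tensor_ideal_def
  proof (rule M.genideal_minimal[OF \<Psi>.kernel_is_ideal], rule subsetI)
    fix r assume r: "r \<in> bilinear_relations k E i L j"
    have "\<Phi> r \<in> ?I" using rel[OF r] M.genideal_self[OF relations_in_carrier] by (auto simp: tensor_ideal_def)
    then have "p (\<Phi> r) = \<zero>\<^bsub>T\<^esub>"
      using M.a_rcos_zero[OF I.ideal_axioms] by (simp add: p_def tensor_ring_def FactRing_def)
    then show "r \<in> a_kernel ?M T (p \<circ> \<Phi>)" using subsetD[OF relations_in_carrier r] by (simp add: a_kernel_def')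
  qed
  then have ker: "\<And>x. x \<in> ?I \<Longrightarrow> (p \<circ> \<Phi>) x = \<zero>\<^bsub>T\<^esub>" by (auto simp: a_kernel_def')
  obtain u where u: "u \<in> ring_hom (?M Quot ?I) T" "\<And>x. x \<in> carrier ?M \<Longrightarrow> u (p x) = (p \<circ> \<Phi>) x"
    using I.quotient_hom_lift[OF ring_tensor \<Psi>.homh ker] unfolding p_def by blast
  show ?thesis
  proof (rule that[of u])
    show "u \<in> ring_hom T T" using u(1) by (simp add: tensor_ring_def)
    show "u (pure e l) = pure e (\<sigma> l)" if "e \<in> carrier E" "l \<in> carrier L" for e l
      using u(2)[of "frag_of (e, l)"] that by (simp add: p_def pure_tensor_def \<Phi>_def f_def)
  qed
qed

end

section \<open>Galois base changes inside an algebraically closed field\<close>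

lemma (in field) subfield_inter:
  assumes "subfield K R" "subfield M R"
  shows "subfield (K \<inter> M) R"
proof (rule subfieldI')
  show "subring (K \<inter> M) R" using subring_inter[OF subfieldE(1)[OF assms(1)] subfieldE(1)[OF assms(2)]] .
  show "inv x \<in> K \<inter> M" if "x \<in> K \<inter> M - {\<zero>}" for x
    using subfield_m_inv(1)[OF assms(1), of x] subfield_m_inv(1)[OF assms(2), of x] that by blast
qed

text \<open>Supplies the domain in A on which a map g defined only on M can be composed with
  h.\<close>

lemma subfield_preimage:
  assumes A: "field A" and B: "field B" and h: "h \<in> ring_hom A B" and M: "subfield M B"
  shows "subfield {x \<in> carrier A. h x \<in> M} A"
proof -
  interpret A: field A by fact
  interpret B: field B by fact
  interpret h: ring_hom_ring A B h using ring_hom_ringI2[OF A.ring_axioms B.ring_axioms h] .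
  note M' = subringE[OF subfieldE(1)[OF M]]
  show ?thesis
  proof (rule A.subfieldI')
    show "subring {x \<in> carrier A. h x \<in> M} A"
      using M'(3,5,6,7) by (intro A.subringI) auto
    fix x assume x: "x \<in> {x \<in> carrier A. h x \<in> M} - {\<zero>\<^bsub>A\<^esub>}"
    then have xU: "x \<in> Units A" by (simp add: A.field_Units)
    have hx: "h x \<in> M - {\<zero>\<^bsub>B\<^esub>}"
      using x non_trivial_field_hom_is_inj[OF h A B] by (auto dest: inj_onD[of h _ x "\<zero>\<^bsub>A\<^esub>"])
    have "h x \<otimes>\<^bsub>B\<^esub> h (inv\<^bsub>A\<^esub> x) = \<one>\<^bsub>B\<^esub>"
      using x xU h.hom_mult[of x "inv\<^bsub>A\<^esub> x"] by simp
    then have "h (inv\<^bsub>A\<^esub> x) \<in> M"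
      using B.subfield_m_inv_simprule[OF M hx, of "h (inv\<^bsub>A\<^esub> x)"] xU M'(3) by simp
    then show "inv\<^bsub>A\<^esub> x \<in> {x \<in> carrier A. h x \<in> M}" using xU by simp
  qed
qed

text \<open>The tower law requires both steps inside one field, so the dimension of L over k is
  first transported along the injective map l into A.\<close>

lemma finite_field_ext_trans:
  assumes L: "finite_field_ext k L j" and A: "finite_field_ext L A l"
  shows "finite_field_ext k A (l \<circ> j)"
proof -
  note L' = finite_field_extD[OF L] and A' = finite_field_extD[OF A]
  interpret A: field A using A'(2) .
  interpret L: field L using L'(2) .
  interpret l: ring_hom_ring L A l using ring_hom_ringI2[OF L.ring_axioms A.ring_axioms A'(3)] .
  interpret lj: ring_hom_ring k A "l \<circ> j"
    using ring_hom_ringI2[OF field.is_ring[OF L'(1)] A.ring_axioms ring_hom_trans[OF L'(3) A'(3)]] .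
  obtain n where n: "L.dimension n (j ` carrier k) (carrier L)"
    using L'(5) by (auto simp: L.finite_dimension_def)
  have "inj_on l (carrier L)" using non_trivial_field_hom_is_inj[OF A'(3,1,2)] .
  then have "A.dimension n (l ` j ` carrier k) (l ` carrier L)"
    using l.inj_hom_dimension[OF L'(4) A.one_not_zero _ n] by simp
  then have "A.finite_dimension (l ` j ` carrier k) (l ` carrier L)" by (rule A.finite_dimensionI)
  moreover have "subfield (l ` j ` carrier k) A" using l.img_is_subfield(2)[OF L'(4) A.one_not_zero] .
  ultimately have "A.finite_dimension (l ` j ` carrier k) (carrier A)"
    using A.telescopic_base_dim(1)[of "l ` j ` carrier k" "l ` carrier L" "carrier A"] A'(4,5) by blast
  then show ?thesis
    using L'(1) A'(2) ring_hom_trans[OF L'(3) A'(3)] by (simp add: finite_field_ext_def image_comp)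
qed

section \<open>Lifting of k-homomorphisms to a Galois base change\<close>

text \<open>An abstract stand-in for the tensor product as A: \<open>endo_eqI\<close> says that A is
  generated by E and L, \<open>twist_endo\<close> provides \<open>1 \<otimes> \<sigma>\<close>, and
  nothing else about cosets is remembered. The map \<open>\<kappa>\<close> is a parameter separate
  from h so that two base changes can share it.\<close>

locale pre_galois_embedding =
  fixes k :: "('k, 'p) ring_scheme" and E :: "('e, 'q) ring_scheme" and i :: "'k \<Rightarrow> 'e"
    and L :: "('l, 'r) ring_scheme" and j :: "'k \<Rightarrow> 'l"
    and A :: "('a, 's) ring_scheme" and \<epsilon> :: "'e \<Rightarrow> 'a" and \<eta> :: "'l \<Rightarrow> 'a"
    and \<Omega> :: "('w, 't) ring_scheme" and \<kappa> :: "'e \<Rightarrow> 'w" and h :: "'a \<Rightarrow> 'w"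
  assumes i: "i \<in> ring_hom k E"
    and galois_L: "finite_galois_ext k L j"
    and galois_A: "finite_galois_ext L A \<eta>"
    and \<epsilon>: "\<epsilon> \<in> ring_hom E A"
    and balanced: "\<And>a. a \<in> carrier k \<Longrightarrow> \<epsilon> (i a) = \<eta> (j a)"
    and endo_eqI: "\<And>f g x. f \<in> ring_hom A A \<Longrightarrow> g \<in> ring_hom A A \<Longrightarrow>
        (\<And>e. e \<in> carrier E \<Longrightarrow> f (\<epsilon> e) = g (\<epsilon> e)) \<Longrightarrow>
        (\<And>y. y \<in> carrier L \<Longrightarrow> f (\<eta> y) = g (\<eta> y)) \<Longrightarrow> x \<in> carrier A \<Longrightarrow> f x = g x"
    and twist_endo: "\<And>\<sigma>. \<sigma> \<in> carrier (galois_group k L j) \<Longrightarrow>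
        \<exists>u \<in> ring_hom A A. (\<forall>e \<in> carrier E. u (\<epsilon> e) = \<epsilon> e) \<and> (\<forall>y \<in> carrier L. u (\<eta> y) = \<eta> (\<sigma> y))"
    and closed: "algebraically_closed \<Omega>"
    and h: "h \<in> ring_hom A \<Omega>"
    and h_\<epsilon>: "\<And>e. e \<in> carrier E \<Longrightarrow> h (\<epsilon> e) = \<kappa> e"
begin

abbreviation "S \<equiv> galois_group L A \<eta>"

lemma ext_L: "finite_field_ext k L j" and ext_A: "finite_field_ext L A \<eta>"
  using galois_L galois_A by (auto simp: finite_galois_ext_def)

sublocale \<Omega>: algebraically_closed \<Omega> by (rule closed)
sublocale A: field A using finite_field_extD(2)[OF ext_A] .
sublocale L: field L using finite_field_extD(2)[OF ext_L] .
sublocale h: ring_hom_ring A \<Omega> h using ring_hom_ringI2[OF A.ring_axioms \<Omega>.ring_axioms h] .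

lemma j_closed: "a \<in> carrier k \<Longrightarrow> j a \<in> carrier L" using finite_field_extD(6)[OF ext_L] .
lemma \<eta>_closed: "y \<in> carrier L \<Longrightarrow> \<eta> y \<in> carrier A" using finite_field_extD(6)[OF ext_A] .
lemma i_closed: "a \<in> carrier k \<Longrightarrow> i a \<in> carrier E" using ring_hom_closed[OF i] .
lemma \<epsilon>_closed: "e \<in> carrier E \<Longrightarrow> \<epsilon> e \<in> carrier A" using ring_hom_closed[OF \<epsilon>] .

lemma inj_h: "inj_on h (carrier A)"
  using non_trivial_field_hom_is_inj[OF h A.field_axioms \<Omega>.field_axioms] .

lemma base_eq: "a \<in> carrier k \<Longrightarrow> h (\<eta> (j a)) = \<kappa> (i a)"
  using balanced h_\<epsilon> i_closed by metis

lemma group_S: "group S" using group_galois_group[OF A.ring_axioms \<eta>_closed] .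
lemma group_Gal_L: "group (galois_group k L j)" using group_galois_group[OF L.ring_axioms j_closed] .

lemma id_hom: "id \<in> ring_hom A A" by (auto simp: ring_hom_def)

text \<open>The twist by the inverse of \<open>\<sigma>\<close> inverts the twist by
  \<open>\<sigma>\<close>, since both composites are the identity on E and on L.\<close>

lemma twist:
  assumes \<sigma>: "\<sigma> \<in> carrier (galois_group k L j)"
  obtains u where "u \<in> ring_hom A A" "bij_betw u (carrier A) (carrier A)"
    "\<And>e. e \<in> carrier E \<Longrightarrow> u (\<epsilon> e) = \<epsilon> e" "\<And>y. y \<in> carrier L \<Longrightarrow> u (\<eta> y) = \<eta> (\<sigma> y)"
proof -
  interpret G: group "galois_group k L j" by (rule group_Gal_L)
  define \<rho> where "\<rho> = inv\<^bsub>galois_group k L j\<^esub> \<sigma>"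
  have \<rho>: "\<rho> \<in> carrier (galois_group k L j)" using \<sigma> by (simp add: \<rho>_def)
  have \<rho>\<sigma>: "\<rho> (\<sigma> y) = y" "\<sigma> (\<rho> y) = y" "\<sigma> y \<in> carrier L" "\<rho> y \<in> carrier L" if "y \<in> carrier L" for y
    using inv_galois_group[OF L.ring_axioms j_closed \<sigma> that] galois_groupD(4)[OF \<sigma> that]
      galois_groupD(4)[OF \<rho> that] by (auto simp: \<rho>_def)
  obtain u where u: "u \<in> ring_hom A A" "\<And>e. e \<in> carrier E \<Longrightarrow> u (\<epsilon> e) = \<epsilon> e"
    "\<And>y. y \<in> carrier L \<Longrightarrow> u (\<eta> y) = \<eta> (\<sigma> y)" using twist_endo[OF \<sigma>] by blast
  obtain v where v: "v \<in> ring_hom A A" "\<And>e. e \<in> carrier E \<Longrightarrow> v (\<epsilon> e) = \<epsilon> e"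
    "\<And>y. y \<in> carrier L \<Longrightarrow> v (\<eta> y) = \<eta> (\<rho> y)" using twist_endo[OF \<rho>] by blast
  have vu: "v (u x) = x" "u (v x) = x" if "x \<in> carrier A" for x
    using endo_eqI[OF ring_hom_trans[OF u(1) v(1)] id_hom _ _ that]
      endo_eqI[OF ring_hom_trans[OF v(1) u(1)] id_hom _ _ that] u v \<rho>\<sigma> by auto
  have "bij_betw u (carrier A) (carrier A)"
    using ring_hom_closed[OF u(1)] ring_hom_closed[OF v(1)] vu
    by (intro bij_betw_byWitness[where f' = v]) auto
  then show ?thesis using that u by blast
qed

text \<open>First extend \<open>g \<circ> h\<close> to all of \<open>A\<close>; on \<open>L\<close> the extension differs from \<open>h\<close> by some
  \<open>\<sigma>\<close> in \<open>Gal(L/k)\<close>. After correcting by \<open>1 \<otimes> \<sigma>\<close> both agree on \<open>L\<close>, hence differ by an element of \<open>Gal(A/L)\<close>.\<close>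

lemma lift:
  assumes M: "subfield M \<Omega>" and base: "\<kappa> ` i ` carrier k \<subseteq> M"
    and g: "g \<in> ring_hom (\<Omega>\<lparr>carrier := M\<rparr>) \<Omega>" and fixes_base: "\<And>a. a \<in> carrier k \<Longrightarrow> g (\<kappa> (i a)) = \<kappa> (i a)"
  obtains f \<sigma> where "f \<in> ring_hom A A" "bij_betw f (carrier A) (carrier A)"
    "\<sigma> \<in> carrier (galois_group k L j)" "\<And>y. y \<in> carrier L \<Longrightarrow> f (\<eta> y) = \<eta> (\<sigma> y)"
    "\<And>x. x \<in> carrier A \<Longrightarrow> h x \<in> M \<Longrightarrow> g (h x) = h (f x)"
proof -
  \<comment> \<open>The composite of g and h makes sense only on the part of A that h sends into
    M.\<close>
  define K where "K = {x \<in> carrier A. h x \<in> M}"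
  have K: "subfield K A"
    unfolding K_def using subfield_preimage[OF A.field_axioms \<Omega>.field_axioms h M] .
  note ext = finite_field_extD[OF finite_field_ext_trans[OF ext_L ext_A]]
  have "(\<eta> \<circ> j) ` carrier k \<subseteq> K"
    using base base_eq j_closed \<eta>_closed by (auto simp: K_def)
  moreover have "g \<circ> h \<in> ring_hom (A\<lparr>carrier := K\<rparr>) \<Omega>"
  proof (rule ring_hom_trans[OF _ g])
    show "h \<in> ring_hom (A\<lparr>carrier := K\<rparr>) (\<Omega>\<lparr>carrier := M\<rparr>)"
      by (rule ring_hom_memI) (auto simp: K_def)
  qed
  ultimately obtain \<psi> where \<psi>: "\<psi> \<in> ring_hom A \<Omega>" "\<And>x. x \<in> K \<Longrightarrow> \<psi> x = g (h x)"
    using extend_hom_finite_dimension[OF A.field_axioms closed ext(4,5) K] by (metis comp_apply)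
  have "\<psi> (\<eta> (j a)) = h (\<eta> (j a))" if a: "a \<in> carrier k" for a
  proof -
    have "\<eta> (j a) \<in> K" using base base_eq[OF a] j_closed[OF a] \<eta>_closed a by (auto simp: K_def)
    then show ?thesis using \<psi>(2) base_eq[OF a] fixes_base[OF a] by simp
  qed
  then obtain \<sigma> where \<sigma>: "\<sigma> \<in> carrier (galois_group k L j)" "\<And>y. y \<in> carrier L \<Longrightarrow> (\<psi> \<circ> \<eta>) y = (h \<circ> \<eta>) (\<sigma> y)"
    using hom_eq_hom_comp_galois[OF galois_L \<Omega>.field_axioms ring_hom_trans[OF finite_field_extD(3)[OF ext_A] \<psi>(1)]
        ring_hom_trans[OF finite_field_extD(3)[OF ext_A] h]] by (metis comp_apply)
  obtain u where u: "u \<in> ring_hom A A" "bij_betw u (carrier A) (carrier A)"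
    "\<And>y. y \<in> carrier L \<Longrightarrow> u (\<eta> y) = \<eta> (\<sigma> y)" using twist[OF \<sigma>(1)] by metis
  have "\<psi> (\<eta> y) = (h \<circ> u) (\<eta> y)" if "y \<in> carrier L" for y
    using \<sigma>(2)[OF that] u(3)[OF that] by simp
  then obtain n where n: "n \<in> carrier S" "\<And>x. x \<in> carrier A \<Longrightarrow> \<psi> x = (h \<circ> u) (n x)"
    using hom_eq_hom_comp_galois[OF galois_A \<Omega>.field_axioms \<psi>(1) ring_hom_trans[OF u(1) h]] by metis
  show ?thesis
  \<comment> \<open>Since n fixes the image of L, composing with u afterwards still induces
    \<open>\<sigma>\<close> there.\<close>
  proof (rule that[of "u \<circ> n" \<sigma>])
    show "u \<circ> n \<in> ring_hom A A" using ring_hom_trans[OF galois_groupD(1)[OF n(1)] u(1)] .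
    show "bij_betw (u \<circ> n) (carrier A) (carrier A)" using bij_betw_trans[OF galois_groupD(3)[OF n(1)] u(2)] .
    show "\<sigma> \<in> carrier (galois_group k L j)" by (rule \<sigma>(1))
    show "(u \<circ> n) (\<eta> y) = \<eta> (\<sigma> y)" if "y \<in> carrier L" for y
      using galois_groupD(5)[OF n(1) that] u(3)[OF that] by simp
    show "g (h x) = h ((u \<circ> n) x)" if "x \<in> carrier A" "h x \<in> M" for x
      using \<psi>(2)[of x] n(2)[of x] that by (simp add: K_def)
  qed
qed

text \<open>A form of normality of A over k: each value of g is an h-image of a value of the lift.
  Used for both base changes, it gives the stability of their intersection.\<close>

lemma lift_range:
  assumes "subfield M \<Omega>" "\<kappa> ` i ` carrier k \<subseteq> M" "M \<subseteq> h ` carrier A"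
    and "g \<in> ring_hom (\<Omega>\<lparr>carrier := M\<rparr>) \<Omega>" "\<And>a. a \<in> carrier k \<Longrightarrow> g (\<kappa> (i a)) = \<kappa> (i a)"
  shows "g ` M \<subseteq> h ` carrier A"
proof -
  obtain f where f: "f \<in> ring_hom A A" "\<And>x. x \<in> carrier A \<Longrightarrow> h x \<in> M \<Longrightarrow> g (h x) = h (f x)"
    using lift[OF assms(1,2,4,5)] by metis
  show ?thesis
  proof (rule image_subsetI)
    fix m assume m: "m \<in> M"
    then obtain x where "x \<in> carrier A" "m = h x" using assms(3) by blast
    then show "g m \<in> h ` carrier A" using f(2)[of x] m ring_hom_closed[OF f(1)] by simp
  qed
qed

end

section \<open>Restriction of the Galois group to a stable intermediate field\<close>

text \<open>M is an arbitrary stable field here rather than an intersection, so that the argument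
  concerns one base change at a time; the other one enters only through
  \<open>stable\<close>.\<close>

locale pre_galois_in_stable_field = pre_galois_embedding +
  fixes M
  assumes M: "subfield M \<Omega>" and M_range: "M \<subseteq> h ` carrier A" and E_M: "\<kappa> ` carrier E \<subseteq> M"
    and stable: "\<And>g. g \<in> ring_hom (\<Omega>\<lparr>carrier := M\<rparr>) \<Omega> \<Longrightarrow>
      (\<And>a. a \<in> carrier k \<Longrightarrow> g (\<kappa> (i a)) = \<kappa> (i a)) \<Longrightarrow> g ` M \<subseteq> M"
begin

abbreviation "\<Gamma> \<equiv> galois_group k (\<Omega>\<lparr>carrier := M\<rparr>) (\<kappa> \<circ> i)"
abbreviation "U \<equiv> {\<gamma> \<in> carrier \<Gamma>. \<forall>e \<in> carrier E. \<gamma> (\<kappa> e) = \<kappa> e}"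

text \<open>The conjugate h n h^-1 cut down to M. The inverse is meaningful since h is injective and
  M lies in its image; restricting the lambda to M makes the result extensional, as elements of
  \<open>\<Gamma>\<close> must be.\<close>

definition conj_restrict
  where "conj_restrict n = (\<lambda>m \<in> M. h (n (inv_into (carrier A) h m)))"

lemma base_M: "\<kappa> ` i ` carrier k \<subseteq> M" using E_M i_closed by blast

lemma ring_M: "ring (\<Omega>\<lparr>carrier := M\<rparr>)"
  using \<Omega>.subring_is_ring[OF subfieldE(1)[OF M]] .

lemma group_\<Gamma>: "group \<Gamma>"
  using group_galois_group[OF ring_M, of k "\<kappa> \<circ> i"] base_M by auto

lemma \<Gamma>_inv_cancel:
  assumes "\<gamma> \<in> carrier \<Gamma>" "m \<in> M"
  shows "(inv\<^bsub>\<Gamma>\<^esub> \<gamma>) (\<gamma> m) = m"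
proof (rule inv_galois_group(1)[OF ring_M _ assms(1)])
  show "\<And>a. a \<in> carrier k \<Longrightarrow> (\<kappa> \<circ> i) a \<in> carrier (\<Omega>\<lparr>carrier := M\<rparr>)" using base_M by auto
qed (simp add: assms(2))

lemma M_E:
  assumes "m \<in> M" obtains x where "x \<in> carrier A" "m = h x"
  using assms M_range by blast

lemma conj_restrict_h: "x \<in> carrier A \<Longrightarrow> h x \<in> M \<Longrightarrow> conj_restrict n (h x) = h (n x)"
  using inj_h by (simp add: conj_restrict_def)

text \<open>Stability speaks of homomorphisms from M into all of \<open>\<Omega>\<close>, so the map
  is first shown to be one over k, and only then confined to M. It fixes k because k maps into L,
  which n fixes.\<close>

lemma conj_restrict_M:
  assumes n: "n \<in> carrier S"
  shows "conj_restrict n \<in> ring_hom (\<Omega>\<lparr>carrier := M\<rparr>) \<Omega>" "\<And>a. a \<in> carrier k \<Longrightarrow> conj_restrict n (\<kappa> (i a)) = \<kappa> (i a)"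
    "\<And>m. m \<in> M \<Longrightarrow> conj_restrict n m \<in> M"
proof -
  note n' = galois_groupD[OF n]
  note M' = subringE[OF subfieldE(1)[OF M]]
  show hom: "conj_restrict n \<in> ring_hom (\<Omega>\<lparr>carrier := M\<rparr>) \<Omega>"
  proof (rule ring_hom_memI)
    fix m m' assume "m \<in> carrier (\<Omega>\<lparr>carrier := M\<rparr>)" "m' \<in> carrier (\<Omega>\<lparr>carrier := M\<rparr>)"
    then have m: "m \<in> M" "m' \<in> M" by auto
    obtain x where x: "x \<in> carrier A" "m = h x" using M_E[OF m(1)] .
    obtain x' where x': "x' \<in> carrier A" "m' = h x'" using M_E[OF m(2)] .
    show "conj_restrict n m \<in> carrier \<Omega>" using conj_restrict_h x m n'(4) by simp
    have "h (x \<otimes>\<^bsub>A\<^esub> x') \<in> M" "h (x \<oplus>\<^bsub>A\<^esub> x') \<in> M" using M'(6,7) m x x' by auto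
    then show "conj_restrict n (m \<otimes>\<^bsub>\<Omega>\<lparr>carrier := M\<rparr>\<^esub> m') = conj_restrict n m \<otimes>\<^bsub>\<Omega>\<^esub> conj_restrict n m'"
      "conj_restrict n (m \<oplus>\<^bsub>\<Omega>\<lparr>carrier := M\<rparr>\<^esub> m') = conj_restrict n m \<oplus>\<^bsub>\<Omega>\<^esub> conj_restrict n m'"
      using conj_restrict_h[of "x \<otimes>\<^bsub>A\<^esub> x'" n] conj_restrict_h[of "x \<oplus>\<^bsub>A\<^esub> x'" n] conj_restrict_h[of _ n] x x' m
        ring_hom_mult[OF n'(1)] ring_hom_add[OF n'(1)] n'(4) by simp_all
  next
    show "conj_restrict n \<one>\<^bsub>\<Omega>\<lparr>carrier := M\<rparr>\<^esub> = \<one>\<^bsub>\<Omega>\<^esub>"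
      using conj_restrict_h[of "\<one>\<^bsub>A\<^esub>" n] M'(3) ring_hom_one[OF n'(1)] by simp
  qed
  show fixes_base: "conj_restrict n (\<kappa> (i a)) = \<kappa> (i a)" if a: "a \<in> carrier k" for a
    using conj_restrict_h[of "\<eta> (j a)" n] base_eq[OF a] base_M a n'(5) j_closed \<eta>_closed by auto
  show "conj_restrict n m \<in> M" if "m \<in> M" for m using stable[OF hom fixes_base] that by blast
qed

lemma conj_restrict_mult:
  assumes n: "n \<in> carrier S" and n': "n' \<in> carrier S" and m: "m \<in> M"
  shows "conj_restrict (n \<otimes>\<^bsub>S\<^esub> n') m = conj_restrict n (conj_restrict n' m)"
proof -
  obtain x where x: "x \<in> carrier A" "m = h x" using M_E[OF m] .
  have "h (n' x) \<in> M" using conj_restrict_h[of x n'] conj_restrict_M(3)[OF n' m] x m by simp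
  then show ?thesis
    using conj_restrict_h x m mult_galois_group[OF n n'] galois_groupD(4)[OF n'] by (simp add: compose_def)
qed

text \<open>Stability gives only a map of M into itself; bijectivity comes from the restriction of
  the inverse of n.\<close>

lemma conj_restrict_closed:
  assumes n: "n \<in> carrier S"
  shows "conj_restrict n \<in> carrier \<Gamma>"
proof -
  interpret S: group S by (rule group_S)
  have inv: "inv\<^bsub>S\<^esub> n \<in> carrier S" using n by simp
  have id: "conj_restrict \<one>\<^bsub>S\<^esub> m = m" if "m \<in> M" for m
    using M_E[OF that] conj_restrict_h that by (metis one_galois_group restrict_apply')
  have "bij_betw (conj_restrict n) M M"
    using conj_restrict_M(3)[OF n] conj_restrict_M(3)[OF inv] id
      conj_restrict_mult[OF n inv] conj_restrict_mult[OF inv n] n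
    by (intro bij_betw_byWitness[where f' = "conj_restrict (inv\<^bsub>S\<^esub> n)"]) auto
  moreover have "conj_restrict n \<in> ring_hom (\<Omega>\<lparr>carrier := M\<rparr>) (\<Omega>\<lparr>carrier := M\<rparr>)"
    using ring_hom_memE[OF conj_restrict_M(1)[OF n]] conj_restrict_M(3)[OF n] by (intro ring_hom_memI) auto
  moreover have "conj_restrict n \<in> extensional M" by (simp add: conj_restrict_def)
  ultimately show ?thesis
    using conj_restrict_M(2)[OF n] by (simp add: carrier_galois_group Bij_def)
qed

lemma conj_restrict_hom: "conj_restrict \<in> hom S \<Gamma>"
proof (rule homI)
  fix n n' assume n: "n \<in> carrier S" and n': "n' \<in> carrier S"
  show "conj_restrict n \<in> carrier \<Gamma>" using conj_restrict_closed[OF n] .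
  show "conj_restrict (n \<otimes>\<^bsub>S\<^esub> n') = conj_restrict n \<otimes>\<^bsub>\<Gamma>\<^esub> conj_restrict n'"
    using conj_restrict_mult[OF n n'] mult_galois_group[OF conj_restrict_closed[OF n] conj_restrict_closed[OF n']]
    by (auto simp: fun_eq_iff compose_def conj_restrict_def)
qed

text \<open>Such an n is the identity on E and on L, which generate A. This serves twice: for the
  injectivity of the restriction map and for the trivial intersection with U.\<close>

lemma fixes_E_imp_one:
  assumes n: "n \<in> carrier S" and fixes_E: "\<And>e. e \<in> carrier E \<Longrightarrow> conj_restrict n (\<kappa> e) = \<kappa> e"
  shows "n = \<one>\<^bsub>S\<^esub>"
proof -
  have "n (\<epsilon> e) = \<epsilon> e" if e: "e \<in> carrier E" for e
  proof -
    have "h (\<epsilon> e) \<in> M" using h_\<epsilon>[OF e] E_M e by auto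
    then have "h (n (\<epsilon> e)) = h (\<epsilon> e)"
      using conj_restrict_h[OF \<epsilon>_closed[OF e], of n] fixes_E[OF e] h_\<epsilon>[OF e] by simp
    then show ?thesis using inj_h galois_groupD(4)[OF n] \<epsilon>_closed[OF e] by (auto dest: inj_onD)
  qed
  then have "n x = x" if "x \<in> carrier A" for x
    using endo_eqI[OF galois_groupD(1)[OF n] id_hom _ _ that] galois_groupD(5)[OF n] by auto
  then show ?thesis
    using galois_groupD(2)[OF n] by (auto simp: one_galois_group fun_eq_iff extensional_def)
qed

lemma \<Gamma>_lift:
  assumes \<gamma>: "\<gamma> \<in> carrier \<Gamma>"
  obtains f \<sigma> where "f \<in> ring_hom A A" "bij_betw f (carrier A) (carrier A)"
    "\<sigma> \<in> carrier (galois_group k L j)" "\<And>y. y \<in> carrier L \<Longrightarrow> f (\<eta> y) = \<eta> (\<sigma> y)"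
    "\<And>x. x \<in> carrier A \<Longrightarrow> h x \<in> M \<Longrightarrow> \<gamma> (h x) = h (f x)"
proof (rule lift[OF M base_M])
  show "\<gamma> \<in> ring_hom (\<Omega>\<lparr>carrier := M\<rparr>) \<Omega>"
    using ring_hom_memE[OF galois_groupD(1)[OF \<gamma>]] subfieldE(3)[OF M] by (intro ring_hom_memI) auto
  show "\<And>a. a \<in> carrier k \<Longrightarrow> \<gamma> (\<kappa> (i a)) = \<kappa> (i a)" using galois_groupD(5)[OF \<gamma>] by simp
qed (use that in blast)

lemma restrict_in_S:
  assumes "f \<in> ring_hom A A" "bij_betw f (carrier A) (carrier A)" "\<And>y. y \<in> carrier L \<Longrightarrow> f (\<eta> y) = \<eta> y"
  shows "restrict f (carrier A) \<in> carrier S"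
  using assms \<eta>_closed by (intro restrict_in_galois_group A.ring_axioms) auto

lemma Gal_L_inv:
  assumes \<sigma>: "\<sigma> \<in> carrier (galois_group k L j)"
  obtains \<rho> where "\<rho> \<in> carrier (galois_group k L j)"
    "\<And>y. y \<in> carrier L \<Longrightarrow> \<rho> y \<in> carrier L \<and> \<sigma> (\<rho> y) = y"
proof (rule that)
  interpret G: group "galois_group k L j" by (rule group_Gal_L)
  show *: "inv\<^bsub>galois_group k L j\<^esub> \<sigma> \<in> carrier (galois_group k L j)" using \<sigma> by simp
  show "(inv\<^bsub>galois_group k L j\<^esub> \<sigma>) y \<in> carrier L \<and> \<sigma> ((inv\<^bsub>galois_group k L j\<^esub> \<sigma>) y) = y"
    if "y \<in> carrier L" for y
    using galois_groupD(4)[OF * that] inv_galois_group(2)[OF L.ring_axioms j_closed \<sigma> that] by blast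
qed

text \<open>A lift f of \<open>\<gamma>\<close> need not fix L, but it acts there by some
  \<open>\<sigma>\<close>. Precomposing with the twist by the inverse of \<open>\<sigma>\<close>
  makes it fix L and leaves its action on E unchanged.\<close>

lemma same_action_on_E:
  assumes \<gamma>: "\<gamma> \<in> carrier \<Gamma>"
  obtains n where "n \<in> carrier S" "\<And>e. e \<in> carrier E \<Longrightarrow> conj_restrict n (\<kappa> e) = \<gamma> (\<kappa> e)"
proof -
  obtain f \<sigma> where f: "f \<in> ring_hom A A" "bij_betw f (carrier A) (carrier A)"
    "\<sigma> \<in> carrier (galois_group k L j)" "\<And>y. y \<in> carrier L \<Longrightarrow> f (\<eta> y) = \<eta> (\<sigma> y)"
    "\<And>x. x \<in> carrier A \<Longrightarrow> h x \<in> M \<Longrightarrow> \<gamma> (h x) = h (f x)" using \<Gamma>_lift[OF \<gamma>] by blast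
  obtain \<rho> where \<rho>: "\<rho> \<in> carrier (galois_group k L j)"
    "\<And>y. y \<in> carrier L \<Longrightarrow> \<rho> y \<in> carrier L \<and> \<sigma> (\<rho> y) = y" using Gal_L_inv[OF f(3)] by blast
  obtain u where u: "u \<in> ring_hom A A" "bij_betw u (carrier A) (carrier A)"
    "\<And>e. e \<in> carrier E \<Longrightarrow> u (\<epsilon> e) = \<epsilon> e" "\<And>y. y \<in> carrier L \<Longrightarrow> u (\<eta> y) = \<eta> (\<rho> y)"
    using twist[OF \<rho>(1)] by blast
  define n where "n = restrict (f \<circ> u) (carrier A)"
  have n: "n \<in> carrier S" unfolding n_def
    using ring_hom_trans[OF u(1) f(1)] bij_betw_trans[OF u(2) f(2)] u(4) f(4) \<rho>(2)
    by (intro restrict_in_S) auto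
  show ?thesis
  proof (rule that[OF n])
    fix e assume e: "e \<in> carrier E"
    have "h (\<epsilon> e) \<in> M" using h_\<epsilon>[OF e] E_M e by auto
    then show "conj_restrict n (\<kappa> e) = \<gamma> (\<kappa> e)"
      using conj_restrict_h[OF \<epsilon>_closed[OF e], of n] f(5)[OF \<epsilon>_closed[OF e]] h_\<epsilon>[OF e] u(3)[OF e] \<epsilon>_closed[OF e]
      by (simp add: n_def)
  qed
qed

text \<open>The source of normality: \<open>\<gamma>\<close> lifts to an automorphism f of A that
  maps L onto itself, so f n f^-1 again fixes L pointwise.\<close>

lemma conj_restrict_conjugate:
  assumes \<gamma>: "\<gamma> \<in> carrier \<Gamma>" and n: "n \<in> carrier S"
  obtains n' where "n' \<in> carrier S" "\<gamma> \<otimes>\<^bsub>\<Gamma>\<^esub> conj_restrict n = conj_restrict n' \<otimes>\<^bsub>\<Gamma>\<^esub> \<gamma>"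
proof -
  obtain f \<sigma> where f: "f \<in> ring_hom A A" "bij_betw f (carrier A) (carrier A)"
    "\<sigma> \<in> carrier (galois_group k L j)" "\<And>y. y \<in> carrier L \<Longrightarrow> f (\<eta> y) = \<eta> (\<sigma> y)"
    "\<And>x. x \<in> carrier A \<Longrightarrow> h x \<in> M \<Longrightarrow> \<gamma> (h x) = h (f x)" using \<Gamma>_lift[OF \<gamma>] by blast
  obtain \<rho> where \<rho>: "\<rho> \<in> carrier (galois_group k L j)"
    "\<And>y. y \<in> carrier L \<Longrightarrow> \<rho> y \<in> carrier L \<and> \<sigma> (\<rho> y) = y" using Gal_L_inv[OF f(3)] by blast
  define f' where "f' = inv_into (carrier A) f"
  have f': "f' \<in> ring_hom A A" "bij_betw f' (carrier A) (carrier A)"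
    using ring_iso_set_sym[OF A.ring_axioms, of f A] f(1,2) bij_betw_inv_into[OF f(2)]
    by (auto simp: f'_def ring_iso_def)
  have f'f: "f' (f x) = x" if "x \<in> carrier A" for x
    using f(2) that by (auto simp: f'_def bij_betw_def)
  have f'\<eta>: "f' (\<eta> y) = \<eta> (\<rho> y)" if "y \<in> carrier L" for y
    using f'f[of "\<eta> (\<rho> y)"] f(4)[of "\<rho> y"] \<rho>(2)[OF that] \<eta>_closed by simp
  define n' where "n' = restrict (f \<circ> (n \<circ> f')) (carrier A)"
  have n': "n' \<in> carrier S" unfolding n'_def
  proof (rule restrict_in_S)
    show "f \<circ> (n \<circ> f') \<in> ring_hom A A"
      using ring_hom_trans[OF ring_hom_trans[OF f'(1) galois_groupD(1)[OF n]] f(1)] .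
    show "bij_betw (f \<circ> (n \<circ> f')) (carrier A) (carrier A)"
      using bij_betw_trans[OF bij_betw_trans[OF f'(2) galois_groupD(3)[OF n]] f(2)] .
    show "(f \<circ> (n \<circ> f')) (\<eta> y) = \<eta> y" if "y \<in> carrier L" for y
      using f'\<eta>[OF that] galois_groupD(5)[OF n] f(4) \<rho>(2)[OF that] by simp
  qed
  show ?thesis
  proof (rule that[OF n'])
    \<comment> \<open>For m = h x both sides are h (f (n x)); on the right the inverse of f inside
      \<open>n'\<close> cancels against the f that lifts \<open>\<gamma>\<close>.\<close>
    have "\<gamma> (conj_restrict n m) = conj_restrict n' (\<gamma> m)" if m: "m \<in> M" for m
    proof -
      obtain x where x: "x \<in> carrier A" "m = h x" using M_E[OF m] .
      have nx: "n x \<in> carrier A" and fx: "f x \<in> carrier A"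
        using galois_groupD(4)[OF n x(1)] ring_hom_closed[OF f(1) x(1)] by auto
      have m2: "h (n x) \<in> M" "conj_restrict n m = h (n x)"
        using conj_restrict_h[of x n] conj_restrict_M(3)[OF n m] x m by auto
      have m3: "\<gamma> m = h (f x)" using f(5)[OF x(1)] x m by simp
      moreover have "\<gamma> m \<in> M" using galois_groupD(4)[OF \<gamma>, of m] m by simp
      ultimately have "conj_restrict n' (\<gamma> m) = h (n' (f x))" using conj_restrict_h[OF fx, of n'] by simp
      then show ?thesis using m2 f(5)[OF nx m2(1)] f'f[OF x(1)] fx by (simp add: n'_def)
    qed
    then show "\<gamma> \<otimes>\<^bsub>\<Gamma>\<^esub> conj_restrict n = conj_restrict n' \<otimes>\<^bsub>\<Gamma>\<^esub> \<gamma>"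
      using mult_galois_group[OF \<gamma> conj_restrict_closed[OF n]] mult_galois_group[OF conj_restrict_closed[OF n'] \<gamma>]
      by (auto simp: fun_eq_iff compose_def)
  qed
qed

lemma subgroup_U: "subgroup U \<Gamma>"
proof -
  interpret \<Gamma>: group \<Gamma> by (rule group_\<Gamma>)
  show ?thesis
  proof (rule \<Gamma>.subgroupI)
    have "\<one>\<^bsub>\<Gamma>\<^esub> (\<kappa> e) = \<kappa> e" if "e \<in> carrier E" for e
      unfolding one_galois_group using E_M that by auto
    then show "U \<noteq> {}" using \<Gamma>.one_closed by blast
  next
    fix \<gamma> assume "\<gamma> \<in> U"
    then have \<gamma>: "\<gamma> \<in> carrier \<Gamma>" "\<And>e. e \<in> carrier E \<Longrightarrow> \<gamma> (\<kappa> e) = \<kappa> e" by auto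
    have "(inv\<^bsub>\<Gamma>\<^esub> \<gamma>) (\<kappa> e) = \<kappa> e" if e: "e \<in> carrier E" for e
      using \<Gamma>_inv_cancel[OF \<gamma>(1), of "\<kappa> e"] E_M e \<gamma>(2)[OF e] by auto
    then show "inv\<^bsub>\<Gamma>\<^esub> \<gamma> \<in> U" using \<gamma>(1) by simp
  next
    fix \<gamma> \<delta> assume \<gamma>\<delta>: "\<gamma> \<in> U" "\<delta> \<in> U"
    then show "\<gamma> \<otimes>\<^bsub>\<Gamma>\<^esub> \<delta> \<in> U"
      using mult_galois_group[of \<gamma> k "\<Omega>\<lparr>carrier := M\<rparr>" "\<kappa> \<circ> i" \<delta>] \<Gamma>.m_closed[of \<gamma> \<delta>] E_M
      by (auto simp: compose_def subset_iff)
  qed auto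
qed

lemma conj_restrict_iso: "S \<cong> \<Gamma>\<lparr>carrier := conj_restrict ` carrier S\<rparr>"
proof -
  interpret S: group S by (rule group_S)
  interpret \<Gamma>: group \<Gamma> by (rule group_\<Gamma>)
  interpret c: group_hom S \<Gamma> conj_restrict
    using conj_restrict_hom by (simp add: group_hom_def group_hom_axioms_def S.group_axioms \<Gamma>.group_axioms)
  have "inj_on conj_restrict (carrier S)"
  proof (subst c.inj_on_one_iff, intro allI impI)
    fix n assume n: "n \<in> carrier S" "conj_restrict n = \<one>\<^bsub>\<Gamma>\<^esub>"
    have "conj_restrict n (\<kappa> e) = \<kappa> e" if "e \<in> carrier E" for e
      unfolding n(2) one_galois_group using E_M that by auto
    then show "n = \<one>\<^bsub>S\<^esub>" by (rule fixes_E_imp_one[OF n(1)])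
  qed
  then have "conj_restrict \<in> iso S (\<Gamma>\<lparr>carrier := conj_restrict ` carrier S\<rparr>)"
    using c.homh by (auto simp: iso_def hom_def bij_betw_def)
  then show ?thesis by (auto simp: is_iso_def)
qed

lemma normal_complement: "normal_complement_of \<Gamma> U (conj_restrict ` carrier S)"
proof -
  interpret S: group S by (rule group_S)
  interpret \<Gamma>: group \<Gamma> by (rule group_\<Gamma>)
  interpret c: group_hom S \<Gamma> conj_restrict
    using conj_restrict_hom by (simp add: group_hom_def group_hom_axioms_def S.group_axioms \<Gamma>.group_axioms)
  have N: "subgroup (conj_restrict ` carrier S) \<Gamma>" by (rule c.img_is_subgroup)
  have "complement_of \<Gamma> U (conj_restrict ` carrier S)"
  proof (rule \<Gamma>.complement_ofI[OF subgroup_U N])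
    fix \<gamma> assume \<gamma>: "\<gamma> \<in> carrier \<Gamma>"
    obtain n where n: "n \<in> carrier S" "\<And>e. e \<in> carrier E \<Longrightarrow> conj_restrict n (\<kappa> e) = \<gamma> (\<kappa> e)"
      using same_action_on_E[OF \<gamma>] by metis
    note c = conj_restrict_closed[OF n(1)]
    \<comment> \<open>As n acts on E like \<open>\<gamma>\<close>, dividing it out of
      \<open>\<gamma>\<close> on the left leaves an element of U.\<close>
    define \<delta> where "\<delta> = inv\<^bsub>\<Gamma>\<^esub> (conj_restrict n) \<otimes>\<^bsub>\<Gamma>\<^esub> \<gamma>"
    have \<delta>: "\<delta> \<in> carrier \<Gamma>" "\<gamma> = conj_restrict n \<otimes>\<^bsub>\<Gamma>\<^esub> \<delta>"
      using c \<gamma> by (simp_all add: \<delta>_def \<Gamma>.m_assoc[symmetric])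
    have "\<delta> (\<kappa> e) = \<kappa> e" if e: "e \<in> carrier E" for e
    proof -
      have "\<kappa> e \<in> M" using E_M e by blast
      then have "\<delta> (\<kappa> e) = (inv\<^bsub>\<Gamma>\<^esub> (conj_restrict n)) (conj_restrict n (\<kappa> e))"
        using mult_galois_group[OF \<Gamma>.inv_closed[OF c] \<gamma>] n(2)[OF e] by (simp add: \<delta>_def compose_def)
      then show ?thesis
        using \<Gamma>_inv_cancel[OF c \<open>\<kappa> e \<in> M\<close>] by simp
    qed
    then show "\<exists>\<nu>\<in>conj_restrict ` carrier S. \<exists>\<delta>\<in>U. \<gamma> = \<nu> \<otimes>\<^bsub>\<Gamma>\<^esub> \<delta>"
      using \<delta> n(1) by blast
  next
    show "conj_restrict ` carrier S \<inter> U \<subseteq> {\<one>\<^bsub>\<Gamma>\<^esub>}"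
    proof
      fix \<nu> assume \<nu>: "\<nu> \<in> conj_restrict ` carrier S \<inter> U"
      then obtain n where n: "n \<in> carrier S" "\<nu> = conj_restrict n" by blast
      then have "n = \<one>\<^bsub>S\<^esub>" using \<nu> by (intro fixes_E_imp_one) auto
      then show "\<nu> \<in> {\<one>\<^bsub>\<Gamma>\<^esub>}" using n(2) c.hom_one by simp
    qed
  qed
  moreover have "conj_restrict ` carrier S \<lhd> \<Gamma>"
  proof (rule \<Gamma>.normal_invI[OF N])
    fix \<gamma> \<nu> assume \<gamma>: "\<gamma> \<in> carrier \<Gamma>" and "\<nu> \<in> conj_restrict ` carrier S"
    then obtain n where n: "n \<in> carrier S" "\<nu> = conj_restrict n" by blast
    obtain n' where n': "n' \<in> carrier S" "\<gamma> \<otimes>\<^bsub>\<Gamma>\<^esub> conj_restrict n = conj_restrict n' \<otimes>\<^bsub>\<Gamma>\<^esub> \<gamma>"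
      using conj_restrict_conjugate[OF \<gamma> n(1)] .
    have "\<gamma> \<otimes>\<^bsub>\<Gamma>\<^esub> \<nu> \<otimes>\<^bsub>\<Gamma>\<^esub> inv\<^bsub>\<Gamma>\<^esub> \<gamma> = conj_restrict n'"
      using n'(2) n \<gamma> conj_restrict_closed[OF n'(1)] by (simp add: \<Gamma>.m_assoc)
    then show "\<gamma> \<otimes>\<^bsub>\<Gamma>\<^esub> \<nu> \<otimes>\<^bsub>\<Gamma>\<^esub> inv\<^bsub>\<Gamma>\<^esub> \<gamma> \<in> conj_restrict ` carrier S" using n'(1) by simp
  qed
  ultimately show ?thesis by (simp add: normal_complement_of_def)
qed

end

section \<open>Uniqueness of simple pre-Galois groups\<close>

text \<open>The embedding h extends \<open>\<kappa>\<close>, read on the copy of E inside the tensor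
  product, to the whole tensor product, which is finite over k through L.\<close>

lemma tensor_embedding:
  assumes E: "finite_field_ext k E i" and L: "finite_galois_ext k L j"
    and T: "finite_galois_ext L (tensor_ring k E i L j) (pure_tensor k E i L j \<one>\<^bsub>E\<^esub>)"
    and \<Omega>: "algebraically_closed \<Omega>" and \<kappa>: "\<kappa> \<in> ring_hom E \<Omega>"
  obtains h where "pre_galois_embedding k E i L j (tensor_ring k E i L j)
    (\<lambda>e. pure_tensor k E i L j e \<one>\<^bsub>L\<^esub>) (pure_tensor k E i L j \<one>\<^bsub>E\<^esub>) \<Omega> \<kappa> h"
proof -
  note E' = finite_field_extD[OF E]
  have extL: "finite_field_ext k L j"
    and extT: "finite_field_ext L (tensor_ring k E i L j) (pure_tensor k E i L j \<one>\<^bsub>E\<^esub>)"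
    using L T by (auto simp: finite_galois_ext_def)
  note L' = finite_field_extD[OF extL] and T' = finite_field_extD[OF extT]
  interpret k: field k by (rule E'(1))
  interpret E: field E by (rule E'(2))
  interpret L: field L by (rule L'(2))
  interpret A: field "tensor_ring k E i L j" by (rule T'(2))
  interpret \<Omega>: algebraically_closed \<Omega> by (rule \<Omega>)
  interpret tensor_of_algebras k E L i j
    using k.cring_axioms E.cring_axioms L.cring_axioms E'(3) L'(3)
    by (simp add: tensor_of_algebras_def tensor_of_algebras_axioms_def)
  let ?\<epsilon> = "\<lambda>e. pure e \<one>\<^bsub>L\<^esub>"
  interpret \<epsilon>: ring_hom_ring E T ?\<epsilon>
    using ring_hom_ringI2[OF E.ring_axioms A.ring_axioms pure_hom_left] .
  have inj: "inj_on ?\<epsilon> (carrier E)"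
    using non_trivial_field_hom_is_inj[OF pure_hom_left E.field_axioms A.field_axioms] .
  note extkT = finite_field_extD[OF finite_field_ext_trans[OF extL extT]]
  \<comment> \<open>The map from k through L lands in the copy of E because scalars of k can be
    moved across the tensor sign.\<close>
  have "(pure \<one>\<^bsub>E\<^esub> \<circ> j) ` carrier k \<subseteq> ?\<epsilon> ` carrier E"
    using pure_balanced E'(6) by (auto simp: image_iff)
  moreover have "subfield (?\<epsilon> ` carrier E) T"
    using \<epsilon>.img_is_subfield(2)[OF E.carrier_is_subfield A.one_not_zero] .
  moreover have "\<kappa> \<circ> inv_into (carrier E) ?\<epsilon> \<in> ring_hom (T\<lparr>carrier := ?\<epsilon> ` carrier E\<rparr>) \<Omega>"
  proof (rule ring_hom_trans[OF _ \<kappa>])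
    have "?\<epsilon> \<in> ring_iso E (T\<lparr>carrier := ?\<epsilon> ` carrier E\<rparr>)"
      using inj ring_hom_memE[OF pure_hom_left] by (auto simp: ring_iso_def bij_betw_def intro!: ring_hom_memI)
    then have "inv_into (carrier E) ?\<epsilon> \<in> ring_iso (T\<lparr>carrier := ?\<epsilon> ` carrier E\<rparr>) E"
      by (rule ring_iso_set_sym[OF E.ring_axioms])
    then show "inv_into (carrier E) ?\<epsilon> \<in> ring_hom (T\<lparr>carrier := ?\<epsilon> ` carrier E\<rparr>) E"
      by (simp add: ring_iso_def)
  qed
  ultimately obtain h where h: "h \<in> ring_hom T \<Omega>"
    "\<And>x. x \<in> ?\<epsilon> ` carrier E \<Longrightarrow> h x = (\<kappa> \<circ> inv_into (carrier E) ?\<epsilon>) x"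
    using extend_hom_finite_dimension[OF A.field_axioms \<Omega> extkT(4,5)] by blast
  have "pre_galois_embedding k E i L j T ?\<epsilon> (pure \<one>\<^bsub>E\<^esub>) \<Omega> \<kappa> h"
  proof (rule pre_galois_embedding.intro)
    show "\<exists>u\<in>ring_hom T T. (\<forall>e\<in>carrier E. u (pure e \<one>\<^bsub>L\<^esub>) = pure e \<one>\<^bsub>L\<^esub>) \<and>
        (\<forall>y\<in>carrier L. u (pure \<one>\<^bsub>E\<^esub> y) = pure \<one>\<^bsub>E\<^esub> (\<sigma> y))"
      if \<sigma>: "\<sigma> \<in> carrier (galois_group k L j)" for \<sigma>
    proof -
      obtain u where "u \<in> ring_hom T T"
        "\<And>e l. e \<in> carrier E \<Longrightarrow> l \<in> carrier L \<Longrightarrow> u (pure e l) = pure e (\<sigma> l)"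
        using right_factor_endomorphism[OF galois_groupD(1,5)[OF \<sigma>]] by blast
      then show ?thesis using ring_hom_one[OF galois_groupD(1)[OF \<sigma>]] by (intro bexI[of _ u]) auto
    qed
    show "f x = g x" if "f \<in> ring_hom T T" "g \<in> ring_hom T T" "\<And>e. e \<in> carrier E \<Longrightarrow> f (pure e \<one>\<^bsub>L\<^esub>) = g (pure e \<one>\<^bsub>L\<^esub>)"
      "\<And>y. y \<in> carrier L \<Longrightarrow> f (pure \<one>\<^bsub>E\<^esub> y) = g (pure \<one>\<^bsub>E\<^esub> y)" "x \<in> carrier T" for f g x
      using hom_eqI[OF A.ring_axioms that] .
    show "h (pure e \<one>\<^bsub>L\<^esub>) = \<kappa> e" if "e \<in> carrier E" for e
      using h(2)[of "pure e \<one>\<^bsub>L\<^esub>"] inv_into_f_f[OF inj that] that by simp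
  qed (fact E'(3) L T pure_hom_left pure_balanced \<Omega> h(1))+
  then show ?thesis by (rule that)
qed

lemma common_normal_complements:
  fixes \<Omega> :: "('w, 't) ring_scheme"
  assumes "pre_galois_embedding k E i L\<^sub>1 j\<^sub>1 A\<^sub>1 \<epsilon>\<^sub>1 \<eta>\<^sub>1 \<Omega> \<kappa> h\<^sub>1"
    and "pre_galois_embedding k E i L\<^sub>2 j\<^sub>2 A\<^sub>2 \<epsilon>\<^sub>2 \<eta>\<^sub>2 \<Omega> \<kappa> h\<^sub>2"
  shows "\<exists>(\<Gamma> :: ('w \<Rightarrow> 'w) monoid) U N\<^sub>1 N\<^sub>2. group \<Gamma> \<and>
    normal_complement_of \<Gamma> U N\<^sub>1 \<and> galois_group L\<^sub>1 A\<^sub>1 \<eta>\<^sub>1 \<cong> \<Gamma>\<lparr>carrier := N\<^sub>1\<rparr> \<and>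
    normal_complement_of \<Gamma> U N\<^sub>2 \<and> galois_group L\<^sub>2 A\<^sub>2 \<eta>\<^sub>2 \<cong> \<Gamma>\<lparr>carrier := N\<^sub>2\<rparr>"
proof -
  interpret e1: pre_galois_embedding k E i L\<^sub>1 j\<^sub>1 A\<^sub>1 \<epsilon>\<^sub>1 \<eta>\<^sub>1 \<Omega> \<kappa> h\<^sub>1 by fact
  interpret e2: pre_galois_embedding k E i L\<^sub>2 j\<^sub>2 A\<^sub>2 \<epsilon>\<^sub>2 \<eta>\<^sub>2 \<Omega> \<kappa> h\<^sub>2 by fact
  define M where "M = h\<^sub>1 ` carrier A\<^sub>1 \<inter> h\<^sub>2 ` carrier A\<^sub>2"
  have M: "subfield M \<Omega>"
    unfolding M_def
    using e1.h.img_is_subfield(2)[OF e1.A.carrier_is_subfield e1.\<Omega>.one_not_zero]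
      e2.h.img_is_subfield(2)[OF e2.A.carrier_is_subfield e1.\<Omega>.one_not_zero]
    by (rule e1.\<Omega>.subfield_inter)
  have E_M: "\<kappa> ` carrier E \<subseteq> M"
    using e1.h_\<epsilon> e2.h_\<epsilon> e1.\<epsilon>_closed e2.\<epsilon>_closed by (auto simp: M_def image_iff) metis+
  then have base_M: "\<kappa> ` i ` carrier k \<subseteq> M" using e1.i_closed by blast
  \<comment> \<open>A homomorphism on M over k sends M into each of the two images separately, hence
    into their intersection.\<close>
  have stable: "g ` M \<subseteq> M"
    if "g \<in> ring_hom (\<Omega>\<lparr>carrier := M\<rparr>) \<Omega>" "\<And>a. a \<in> carrier k \<Longrightarrow> g (\<kappa> (i a)) = \<kappa> (i a)" for g
    using e1.lift_range[OF M base_M _ that] e2.lift_range[OF M base_M _ that] by (auto simp: M_def)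
  interpret s1: pre_galois_in_stable_field k E i L\<^sub>1 j\<^sub>1 A\<^sub>1 \<epsilon>\<^sub>1 \<eta>\<^sub>1 \<Omega> \<kappa> h\<^sub>1 M
  proof (rule pre_galois_in_stable_field.intro[OF assms(1)], rule pre_galois_in_stable_field_axioms.intro)
    show "M \<subseteq> h\<^sub>1 ` carrier A\<^sub>1" by (simp add: M_def)
  qed (fact M E_M stable)+
  interpret s2: pre_galois_in_stable_field k E i L\<^sub>2 j\<^sub>2 A\<^sub>2 \<epsilon>\<^sub>2 \<eta>\<^sub>2 \<Omega> \<kappa> h\<^sub>2 M
  proof (rule pre_galois_in_stable_field.intro[OF assms(2)], rule pre_galois_in_stable_field_axioms.intro)
    show "M \<subseteq> h\<^sub>2 ` carrier A\<^sub>2" by (simp add: M_def)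
  qed (fact M E_M stable)+
  show ?thesis
    \<comment> \<open>\<open>\<Gamma>\<close> and U are built from k, E, i, \<open>\<kappa>\<close>,
      \<open>\<Omega>\<close> and M alone, so both interpretations yield the same group and
      subgroup, and the facts of the second fit the witnesses of the first.\<close>
    by (rule exI[of _ s1.\<Gamma>], rule exI[of _ s1.U],
        rule exI[of _ "s1.conj_restrict ` carrier e1.S"], rule exI[of _ "s2.conj_restrict ` carrier e2.S"])
      (intro conjI s1.group_\<Gamma> s1.normal_complement s1.conj_restrict_iso
        s2.normal_complement s2.conj_restrict_iso)
qed

theorem pre_galois_group_unique_if_simple:
  fixes G :: "('g, 'b) monoid_scheme" and E :: "('e, 'q) ring_scheme"
  assumes G: "simple_group G" and E: "finite_field_ext k E i" and H: "group H"
    and L\<^sub>1: "pre_galois_via k E i L\<^sub>1 j\<^sub>1 G" and L\<^sub>2: "pre_galois_via k E i L\<^sub>2 j\<^sub>2 H"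
  shows "H \<cong> G"
proof -
  interpret E: field E using finite_field_extD(2)[OF E] .
  \<comment> \<open>The type of this closure depends only on that of E, so it can receive base
    changes along auxiliary fields of unrelated types. The embedding of E as constants plays the
    role of \<open>\<kappa>\<close> for both.\<close>
  obtain \<Omega> :: "(('e list \<times> nat) multiset \<Rightarrow> 'e) ring" where
    \<Omega>: "algebraic_closure \<Omega> (E.indexed_const ` carrier E)" and \<kappa>: "E.indexed_const \<in> ring_hom E \<Omega>"
    using E.exists_closure .
  interpret algebraic_closure \<Omega> "E.indexed_const ` carrier E" by (rule \<Omega>)
  have closed: "algebraically_closed \<Omega>" by unfold_locales
  let ?A\<^sub>1 = "tensor_ring k E i L\<^sub>1 j\<^sub>1" and ?A\<^sub>2 = "tensor_ring k E i L\<^sub>2 j\<^sub>2"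
  let ?G\<^sub>1 = "galois_group L\<^sub>1 ?A\<^sub>1 (pure_tensor k E i L\<^sub>1 j\<^sub>1 \<one>\<^bsub>E\<^esub>)"
    and ?G\<^sub>2 = "galois_group L\<^sub>2 ?A\<^sub>2 (pure_tensor k E i L\<^sub>2 j\<^sub>2 \<one>\<^bsub>E\<^esub>)"
  obtain h\<^sub>1 where h\<^sub>1: "pre_galois_embedding k E i L\<^sub>1 j\<^sub>1 ?A\<^sub>1
      (\<lambda>e. pure_tensor k E i L\<^sub>1 j\<^sub>1 e \<one>\<^bsub>L\<^sub>1\<^esub>) (pure_tensor k E i L\<^sub>1 j\<^sub>1 \<one>\<^bsub>E\<^esub>) \<Omega> E.indexed_const h\<^sub>1"
    using tensor_embedding[OF E _ _ closed \<kappa>] L\<^sub>1 by (auto simp: pre_galois_via_def)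
  obtain h\<^sub>2 where h\<^sub>2: "pre_galois_embedding k E i L\<^sub>2 j\<^sub>2 ?A\<^sub>2
      (\<lambda>e. pure_tensor k E i L\<^sub>2 j\<^sub>2 e \<one>\<^bsub>L\<^sub>2\<^esub>) (pure_tensor k E i L\<^sub>2 j\<^sub>2 \<one>\<^bsub>E\<^esub>) \<Omega> E.indexed_const h\<^sub>2"
    using tensor_embedding[OF E _ _ closed \<kappa>] L\<^sub>2 by (auto simp: pre_galois_via_def)
  obtain \<Gamma> :: "((('e list \<times> nat) multiset \<Rightarrow> 'e) \<Rightarrow> (('e list \<times> nat) multiset \<Rightarrow> 'e)) monoid" and U N\<^sub>1 N\<^sub>2
    where \<Gamma>: "group \<Gamma>" and N\<^sub>1: "normal_complement_of \<Gamma> U N\<^sub>1" "?G\<^sub>1 \<cong> \<Gamma>\<lparr>carrier := N\<^sub>1\<rparr>"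
      and N\<^sub>2: "normal_complement_of \<Gamma> U N\<^sub>2" "?G\<^sub>2 \<cong> \<Gamma>\<lparr>carrier := N\<^sub>2\<rparr>"
    using common_normal_complements[OF h\<^sub>1 h\<^sub>2] by blast
  have "\<Gamma>\<lparr>carrier := N\<^sub>1\<rparr> \<cong> ?G\<^sub>1"
    using group.iso_sym[OF pre_galois_embedding.group_S[OF h\<^sub>1] N\<^sub>1(2)] .
  also have "?G\<^sub>1 \<cong> G" using L\<^sub>1 by (simp add: pre_galois_via_def)
  finally have "\<Gamma>\<lparr>carrier := N\<^sub>2\<rparr> \<cong> G"
    using group.simple_normal_complement_unique[OF \<Gamma> G N\<^sub>1(1) _ N\<^sub>2(1)] by blast
  have "?G\<^sub>2 \<cong> H" using L\<^sub>2 by (simp add: pre_galois_via_def)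
  then have "H \<cong> ?G\<^sub>2" by (rule group.iso_sym[OF pre_galois_embedding.group_S[OF h\<^sub>2]])
  also note N\<^sub>2(2)
  also note \<open>\<Gamma>\<lparr>carrier := N\<^sub>2\<rparr> \<cong> G\<close>
  finally show ?thesis .
qed

theorem proposition2p18:
  fixes G :: "'g monoid"
  assumes "simple_group G" and "finite (carrier G)"
  shows
    "(\<forall>(\<Gamma> :: 'a monoid) U N.
        group \<Gamma> \<and> normal_complement_of \<Gamma> U N \<and> \<Gamma>\<lparr>carrier := N\<rparr> \<cong> G \<longrightarrow>
        (\<forall>V. normal_complement_of \<Gamma> U V \<longrightarrow> \<Gamma>\<lparr>carrier := V\<rparr> \<cong> G)) \<and>
     (\<forall>(k :: 'k ring) (E :: 'e ring) i.
        is_pre_galois_group TYPE('l) k E i G \<longrightarrow>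
        (\<forall>H :: 'h monoid. is_pre_galois_group TYPE('m) k E i H \<longrightarrow> H \<cong> G))"
proof (intro conjI allI impI)
  fix \<Gamma> :: "'a monoid" and U N V
  assume "group \<Gamma> \<and> normal_complement_of \<Gamma> U N \<and> \<Gamma>\<lparr>carrier := N\<rparr> \<cong> G"
    and "normal_complement_of \<Gamma> U V"
  then show "\<Gamma>\<lparr>carrier := V\<rparr> \<cong> G"
    using group.simple_normal_complement_unique[OF _ assms(1)] by blast
next
  fix k :: "'k ring" and E :: "'e ring" and i and H :: "'h monoid"
  assume "is_pre_galois_group TYPE('l) k E i G" and "is_pre_galois_group TYPE('m) k E i H"
  then show "H \<cong> G"
    using pre_galois_group_unique_if_simple[OF assms(1)] unfolding is_pre_galois_group_def by blast
qed

end
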